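(* Every KMS$_\beta$ state of $(\mathcal T(\mathbb N\rtimes\mathbb N^\times),\sigma)$ factors through $q_{\mathrm{add}}$. A ground state of $(\mathcal T(\mathbb N\rtimes\mathbb N^\times),\sigma)$ factors through $q_{\mathrm{add}}$ if and only if it is a KMS$_\infty$ state.
   Context: $\mathbb N=\{0,1,2,\dots\}$ (additive), $\mathbb N^\times=\{1,2,\dots\}$ (multiplicative), $\mathcal P$ = primes. $\mathbb N\rtimes\mathbb N^\times$ has product $(m,a)(n,b)=(m+an,ab)$. The Toeplitz algebra $\mathcal T(\mathbb N\rtimes\mathbb N^\times)\subset B(\ell^2(\mathbb N\rtimes\mathbb N^\times))$ is generated by the isometries $T_ye_x=e_{yx}$; by a theorem of Laca–Raeburn it is the universal $C^*$-algebra generated by isometries $s=T_{(1,1)}$, $v_p=T_{(0,p)}$ ($p\in\mathcal P$) satisfying (T1) $v_ps=s^pv_p$; (T2) $v_pv_q=v_qv_p$; (T3) $v_p^*v_q=v_qv_p^*$ for $p\neq q$; (T4) $s^*v_p=s^{p-1}v_ps^*$; (T5) $v_p^*s^kv_p=0$ for $1\le k<p$. The map $q_{\mathrm{add}}:\mathcal T(\mathbb N\rtimes\mathbb N^\times)\to\mathcal T_{\mathrm{add}}(\mathbb N\rtimes\mathbb N^\times)$ is the quotient map by the ideal generated by $1-ss^*$. The dynamics $\sigma:\mathbb R\to\mathrm{Aut}\,\mathcal T(\mathbb N\rtimes\mathbb N^\times)$ is characterised by $\sigma_t(s)=s$ and $\sigma_t(v_p)=p^{it}v_p$. For a dynamical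 system $(C,\sigma)$, an element $c$ is analytic if $t\mapsto\sigma_t(c)$ extends to an entire function $z\mapsto\sigma_z(c)$. For real $\beta$, a KMS$_\beta$ state (inverse temperature $\beta$) is a state $\phi$ with $\phi(cd)=\phi(d\,\sigma_{i\beta}(c))$ for all analytic $c,d$ (with $\sigma$-invariance also required if $\beta=0$). A KMS$_\infty$ state is a weak* limit of KMS$_{\beta}$ states as $\beta\to\infty$. A ground state is a state $\phi$ such that $z\mapsto\phi(c\,\sigma_z(d))$ is bounded on the upper half-plane for every pair of analytic elements $c,d$. The first assertion covers all $\beta$, including $\beta=\infty$. *)

theory Defs
  imports "HOL-Analysis.Analysis"
begin

section \<open>Complex normed spaces\<close>

class complex_normed_vector = real_normed_vector +
  fixes scaleC :: "complex \<Rightarrow> 'a \<Rightarrow> 'a"  (infixr \<open>*\<^sub>C\<close> 75)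
  assumes scaleC_add_right: "a *\<^sub>C (x + y) = a *\<^sub>C x + a *\<^sub>C y"
    and scaleC_add_left: "(a + b) *\<^sub>C x = a *\<^sub>C x + b *\<^sub>C x"
    and scaleC_scaleC: "a *\<^sub>C (b *\<^sub>C x) = (a * b) *\<^sub>C x"
    and scaleR_scaleC: "r *\<^sub>R x = complex_of_real r *\<^sub>C x"
    and norm_scaleC: "norm (a *\<^sub>C x) = cmod a * norm x"

lemma scaleC_one: "1 *\<^sub>C (x :: 'a :: complex_normed_vector) = x"
  using scaleR_scaleC[of 1 x] by simp

lemma scaleC_zero: "0 *\<^sub>C (x :: 'a :: complex_normed_vector) = 0"
  using scaleR_scaleC[of 0 x] by simp


section \<open>The Hilbert space of square-summable families\<close>

lemma abs_summable_mult_square_summable: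
  fixes f g :: "'a \<Rightarrow> complex"
  assumes "(\<lambda>x. (cmod (f x))\<^sup>2) summable_on UNIV" "(\<lambda>x. (cmod (g x))\<^sup>2) summable_on UNIV"
  shows "(\<lambda>x. norm (f x * cnj (g x))) summable_on UNIV"
proof (rule summable_on_comparison_test)
  show "(\<lambda>x. (cmod (f x))\<^sup>2 + (cmod (g x))\<^sup>2) summable_on UNIV"
    by (rule summable_on_add[OF assms])
  fix x
  have "2 * (cmod (f x) * cmod (g x)) \<le> (cmod (f x))\<^sup>2 + (cmod (g x))\<^sup>2"
    using sum_squares_bound[of "cmod (f x)" "cmod (g x)"] by simp
  moreover have "0 \<le> cmod (f x) * cmod (g x)" by simp
  ultimately show "norm (f x * cnj (g x)) \<le> (cmod (f x))\<^sup>2 + (cmod (g x))\<^sup>2"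
    unfolding norm_mult complex_mod_cnj by linarith
qed auto

lemma square_summable_add:
  fixes f g :: "'a \<Rightarrow> complex"
  assumes "(\<lambda>x. (cmod (f x))\<^sup>2) summable_on UNIV" "(\<lambda>x. (cmod (g x))\<^sup>2) summable_on UNIV"
  shows "(\<lambda>x. (cmod (f x + g x))\<^sup>2) summable_on UNIV"
proof (rule summable_on_comparison_test)
  show "(\<lambda>x. 2 * ((cmod (f x))\<^sup>2 + (cmod (g x))\<^sup>2)) summable_on UNIV"
    by (intro summable_on_cmult_right summable_on_add assms)
  fix x
  have "(cmod (f x + g x))\<^sup>2 \<le> (cmod (f x) + cmod (g x))\<^sup>2"
    by (intro power_mono norm_triangle_ineq) auto
  also have "\<dots> \<le> 2 * ((cmod (f x))\<^sup>2 + (cmod (g x))\<^sup>2)"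
    using sum_squares_bound[of "cmod (f x)" "cmod (g x)"] by (simp add: power2_sum)
  finally show "(cmod (f x + g x))\<^sup>2 \<le> 2 * ((cmod (f x))\<^sup>2 + (cmod (g x))\<^sup>2)" .
qed auto

lemma square_summable_scale:
  fixes f :: "'a \<Rightarrow> complex"
  assumes "(\<lambda>x. (cmod (f x))\<^sup>2) summable_on UNIV"
  shows "(\<lambda>x. (cmod (c * f x))\<^sup>2) summable_on UNIV"
  unfolding norm_mult power_mult_distrib by (intro summable_on_cmult_right assms)

typedef 'a ell2 = "{f :: 'a \<Rightarrow> complex. (\<lambda>x. (cmod (f x))\<^sup>2) summable_on UNIV}"
  morphisms ell2_coord Abs_ell2
  by (rule exI[of _ "\<lambda>_. 0"]) simp

setup_lifting type_definition_ell2

lift_definition cinner :: "'a ell2 \<Rightarrow> 'a ell2 \<Rightarrow> complex" is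
  "\<lambda>f g. \<Sum>\<^sub>\<infinity>x. f x * cnj (g x)" .

lift_definition ket :: "'a \<Rightarrow> 'a ell2" is "\<lambda>x y. if y = x then 1 else 0"
proof -
  fix x :: 'a
  have "(\<lambda>y. (cmod (if y = x then 1 else 0))\<^sup>2) summable_on {x}" by simp
  then show "(\<lambda>y. (cmod (if y = x then 1 else 0))\<^sup>2) summable_on UNIV"
    by (rule summable_on_cong_neutral[THEN iffD1, rotated -1]) auto
qed

lemma coord_mult_summable: "(\<lambda>x. ell2_coord f x * cnj (ell2_coord g x)) summable_on UNIV"
  using abs_summable_mult_square_summable[of "ell2_coord f" "ell2_coord g"] ell2_coord[of f] ell2_coord[of g]
  by (auto intro: abs_summable_summable)

instantiation ell2 :: (type) real_vector
begin

lift_definition zero_ell2 :: "'a ell2" is "\<lambda>_. 0" by simp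
lift_definition plus_ell2 :: "'a ell2 \<Rightarrow> 'a ell2 \<Rightarrow> 'a ell2" is "\<lambda>f g x. f x + g x"
  by (rule square_summable_add)
lift_definition uminus_ell2 :: "'a ell2 \<Rightarrow> 'a ell2" is "\<lambda>f x. - f x" by simp
lift_definition minus_ell2 :: "'a ell2 \<Rightarrow> 'a ell2 \<Rightarrow> 'a ell2" is "\<lambda>f g x. f x - g x"
  subgoal for f g using square_summable_add[of f "\<lambda>x. - g x"] by simp
  done
lift_definition scaleR_ell2 :: "real \<Rightarrow> 'a ell2 \<Rightarrow> 'a ell2" is "\<lambda>r f x. complex_of_real r * f x"
  by (rule square_summable_scale)

instance
  by standard (transfer; simp add: fun_eq_iff algebra_simps)+

end

instantiation ell2 :: (type) real_inner
begin

definition inner_ell2 :: "'a ell2 \<Rightarrow> 'a ell2 \<Rightarrow> real" where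
  "inner_ell2 f g = Re (cinner f g)"
definition norm_ell2 :: "'a ell2 \<Rightarrow> real" where
  "norm_ell2 f = sqrt (\<Sum>\<^sub>\<infinity>x. (cmod (ell2_coord f x))\<^sup>2)"
definition dist_ell2 :: "'a ell2 \<Rightarrow> 'a ell2 \<Rightarrow> real" where
  "dist_ell2 f g = norm (f - g)"
definition sgn_ell2 :: "'a ell2 \<Rightarrow> 'a ell2" where
  "sgn_ell2 f = f /\<^sub>R norm f"
definition uniformity_ell2 :: "('a ell2 \<times> 'a ell2) filter" where
  "uniformity_ell2 = (INF e\<in>{0<..}. principal {(f, g). dist f g < e})"
definition open_ell2 :: "'a ell2 set \<Rightarrow> bool" where
  "open_ell2 U \<longleftrightarrow> (\<forall>f\<in>U. \<forall>\<^sub>F (f', g) in uniformity. f' = f \<longrightarrow> g \<in> U)"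

lemma cinner_self: "cinner f f = complex_of_real (\<Sum>\<^sub>\<infinity>x. (cmod (ell2_coord f x))\<^sup>2)"
proof -
  have "((\<lambda>x. (cmod (ell2_coord f x))\<^sup>2) has_sum (\<Sum>\<^sub>\<infinity>x. (cmod (ell2_coord f x))\<^sup>2)) UNIV"
    using ell2_coord[of f] by (simp add: has_sum_infsum)
  from has_sum_of_real[OF this, where 'a=complex] show ?thesis
    unfolding cinner.rep_eq complex_norm_square by (rule infsumI)
qed

lemma cinner_commute: "cinner f g = cnj (cinner g f)"
  unfolding cinner.rep_eq infsum_cnj[symmetric] by (simp add: mult.commute)

lemma cinner_add_left: "cinner (f + g) h = cinner f h + cinner g h"
  unfolding cinner.rep_eq plus_ell2.rep_eq distrib_right
  by (rule infsum_add[OF coord_mult_summable coord_mult_summable])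

instance
proof
  fix f g h :: "'a ell2" and r :: real
  show "inner f g = inner g f"
    unfolding inner_ell2_def by (subst cinner_commute) simp
  show "inner (f + g) h = inner f h + inner g h"
    unfolding inner_ell2_def cinner_add_left by simp
  have "cinner (r *\<^sub>R f) g = complex_of_real r * cinner f g"
    unfolding cinner.rep_eq scaleR_ell2.rep_eq mult.assoc by (rule infsum_cmult_right')
  then show "inner (r *\<^sub>R f) g = r * inner f g"
    unfolding inner_ell2_def by simp
  show "0 \<le> inner f f"
    unfolding inner_ell2_def cinner_self by (simp add: infsum_nonneg)
  have "f = 0" if "(\<Sum>\<^sub>\<infinity>x. (cmod (ell2_coord f x))\<^sup>2) = 0"
  proof -
    have "(cmod (ell2_coord f x))\<^sup>2 = 0" for x
      by (rule nonneg_infsum_le_0D[where A=UNIV and f="\<lambda>x. (cmod (ell2_coord f x))\<^sup>2"])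
        (use that ell2_coord[of f] in auto)
    then show ?thesis by (auto simp: zero_ell2.rep_eq simp flip: ell2_coord_inject)
  qed
  then show "inner f f = 0 \<longleftrightarrow> f = 0"
    unfolding inner_ell2_def cinner_self by (auto simp: zero_ell2.rep_eq)
  show "norm f = sqrt (inner f f)"
    unfolding inner_ell2_def cinner_self norm_ell2_def by simp
qed (simp_all add: dist_ell2_def sgn_ell2_def uniformity_ell2_def open_ell2_def)

end

instantiation ell2 :: (type) complex_normed_vector
begin

lift_definition scaleC_ell2 :: "complex \<Rightarrow> 'a ell2 \<Rightarrow> 'a ell2" is "\<lambda>c f x. c * f x"
  by (rule square_summable_scale)

instance
proof
  fix a b :: complex and f g :: "'a ell2" and r :: real
  show "a *\<^sub>C (f + g) = a *\<^sub>C f + a *\<^sub>C g" by transfer (simp add: algebra_simps)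
  show "(a + b) *\<^sub>C f = a *\<^sub>C f + b *\<^sub>C f" by transfer (simp add: algebra_simps)
  show "a *\<^sub>C (b *\<^sub>C f) = (a * b) *\<^sub>C f" by transfer (simp add: algebra_simps)
  show "r *\<^sub>R f = complex_of_real r *\<^sub>C f" by transfer simp
  have "(\<Sum>\<^sub>\<infinity>x. (cmod (a * ell2_coord f x))\<^sup>2) = (cmod a)\<^sup>2 * (\<Sum>\<^sub>\<infinity>x. (cmod (ell2_coord f x))\<^sup>2)"
    unfolding norm_mult power_mult_distrib by (rule infsum_cmult_right')
  then show "norm (a *\<^sub>C f) = cmod a * norm f"
    unfolding norm_ell2_def scaleC_ell2.rep_eq by (simp add: real_sqrt_mult)
qed

end

lemma norm_ket: "norm (ket x) = 1"
proof -
  have "(\<Sum>\<^sub>\<infinity>y. (cmod (ell2_coord (ket x) y))\<^sup>2) = (\<Sum>\<^sub>\<infinity>y\<in>{x}. (cmod (ell2_coord (ket x) y))\<^sup>2)"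
    by (rule infsum_cong_neutral) (auto simp: ket.rep_eq)
  then show ?thesis unfolding norm_ell2_def by (simp add: ket.rep_eq)
qed


lifting_update ell2.lifting
lifting_forget ell2.lifting


section \<open>Bounded complex-linear operators\<close>

typedef 'a bop = "{x :: 'a ell2 \<Rightarrow>\<^sub>L 'a ell2. \<forall>c \<xi>. x (c *\<^sub>C \<xi>) = c *\<^sub>C x \<xi>}"
  morphisms blinfun_of_bop Abs_bop
  by (rule exI[of _ 0]) (auto intro: norm_eq_zero[THEN iffD1] simp: norm_scaleC)

setup_lifting type_definition_bop

lift_definition bop_apply :: "'a bop \<Rightarrow> 'a ell2 \<Rightarrow> 'a ell2"  (infixr \<open>\<cdot>\<close> 75) is blinfun_apply .

lemma scaleC_diff_right: "c *\<^sub>C ((x :: 'a :: complex_normed_vector) - y) = c *\<^sub>C x - c *\<^sub>C y"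
  using scaleC_add_right[of c "x - y" y] by simp

lemma scaleC_minus_right: "c *\<^sub>C (- (x :: 'a :: complex_normed_vector)) = - (c *\<^sub>C x)"
  using scaleC_diff_right[of c x x] scaleC_diff_right[of c 0 x] by simp

lemma scaleC_scaleR_commute: "c *\<^sub>C (r *\<^sub>R (x :: 'a :: complex_normed_vector)) = r *\<^sub>R (c *\<^sub>C x)"
  by (simp add: scaleR_scaleC scaleC_scaleC mult.commute)

lemma bounded_linear_scaleC: "bounded_linear (\<lambda>x :: 'a :: complex_normed_vector. c *\<^sub>C x)"
  by (rule bounded_linear_intro[where K="cmod c"])
    (auto simp: scaleC_add_right scaleC_scaleR_commute norm_scaleC)

instantiation bop :: (type) real_vector
begin

lift_definition zero_bop :: "'a bop" is 0
  by (auto intro: norm_eq_zero[THEN iffD1] simp: norm_scaleC)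
lift_definition plus_bop :: "'a bop \<Rightarrow> 'a bop \<Rightarrow> 'a bop" is "(+)"
  by (simp add: blinfun.bilinear_simps scaleC_add_right)
lift_definition minus_bop :: "'a bop \<Rightarrow> 'a bop \<Rightarrow> 'a bop" is "(-)"
  by (simp add: blinfun.bilinear_simps scaleC_diff_right)
lift_definition uminus_bop :: "'a bop \<Rightarrow> 'a bop" is uminus
  by (simp add: blinfun.bilinear_simps scaleC_minus_right)
lift_definition scaleR_bop :: "real \<Rightarrow> 'a bop \<Rightarrow> 'a bop" is "(*\<^sub>R)"
  by (simp add: blinfun.bilinear_simps scaleC_scaleR_commute)

instance
proof
  fix x y z :: "'a bop" and r r' :: real
  show "x + y + z = x + (y + z)" by transfer (simp add: algebra_simps)
  show "x + y = y + x" by transfer (simp add: algebra_simps)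
  show "0 + x = x" by transfer simp
  show "- x + x = 0" by transfer simp
  show "x - y = x + - y" by transfer simp
  show "r *\<^sub>R (x + y) = r *\<^sub>R x + r *\<^sub>R y" by transfer (simp add: algebra_simps)
  show "(r + r') *\<^sub>R x = r *\<^sub>R x + r' *\<^sub>R x" by transfer (simp add: algebra_simps)
  show "r *\<^sub>R r' *\<^sub>R x = (r * r') *\<^sub>R x" by transfer simp
  show "1 *\<^sub>R x = x" by transfer simp
qed

end

instantiation bop :: (type) real_normed_algebra_1
begin

lift_definition one_bop :: "'a bop" is id_blinfun by simp
lift_definition times_bop :: "'a bop \<Rightarrow> 'a bop \<Rightarrow> 'a bop" is "(o\<^sub>L)" by simp
lift_definition norm_bop :: "'a bop \<Rightarrow> real" is norm .
definition dist_bop :: "'a bop \<Rightarrow> 'a bop \<Rightarrow> real" where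
  "dist_bop x y = norm (x - y)"
definition sgn_bop :: "'a bop \<Rightarrow> 'a bop" where
  "sgn_bop x = x /\<^sub>R norm x"
definition uniformity_bop :: "('a bop \<times> 'a bop) filter" where
  "uniformity_bop = (INF e\<in>{0<..}. principal {(x, y). dist x y < e})"
definition open_bop :: "'a bop set \<Rightarrow> bool" where
  "open_bop U \<longleftrightarrow> (\<forall>x\<in>U. \<forall>\<^sub>F (x', y) in uniformity. x' = x \<longrightarrow> y \<in> U)"

instance
proof
  fix x y z :: "'a bop" and r r' :: real
  show "x * y * z = x * (y * z)" by transfer (simp add: blinfun_eqI)
  show "(x + y) * z = x * z + y * z" by transfer (simp add: blinfun_eqI blinfun.bilinear_simps)
  show "x * (y + z) = x * y + x * z" by transfer (simp add: blinfun_eqI blinfun.bilinear_simps)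
  show "r *\<^sub>R x * y = r *\<^sub>R (x * y)" by transfer (simp add: blinfun_eqI blinfun.bilinear_simps)
  show "x * r *\<^sub>R y = r *\<^sub>R (x * y)" by transfer (simp add: blinfun_eqI blinfun.bilinear_simps)
  show "1 * x = x" by transfer (simp add: blinfun_eqI)
  show "x * 1 = x" by transfer (simp add: blinfun_eqI)
  have ne: "(id_blinfun :: 'a ell2 \<Rightarrow>\<^sub>L 'a ell2) \<noteq> 0"
  proof
    assume "(id_blinfun :: 'a ell2 \<Rightarrow>\<^sub>L 'a ell2) = 0"
    then have "id_blinfun (ket undefined :: 'a ell2) = (0 :: 'a ell2 \<Rightarrow>\<^sub>L 'a ell2) (ket undefined)" by simp
    then have "(ket undefined :: 'a ell2) = 0" by simp
    then show False using norm_ket[of "undefined :: 'a"] by simp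
  qed
  then show "(0 :: 'a bop) \<noteq> 1" by transfer simp
  show "norm x = 0 \<longleftrightarrow> x = 0" by transfer simp
  show "norm (x + y) \<le> norm x + norm y" by transfer (rule norm_triangle_ineq)
  show "norm (r *\<^sub>R x) = \<bar>r\<bar> * norm x" by transfer simp
  show "norm (x * y) \<le> norm x * norm y" by transfer (rule norm_blinfun_compose)
  have "norm (id_blinfun :: 'a ell2 \<Rightarrow>\<^sub>L 'a ell2) = 1"
  proof (rule antisym[OF norm_blinfun_id_le])
    show "1 \<le> norm (id_blinfun :: 'a ell2 \<Rightarrow>\<^sub>L 'a ell2)"
      using norm_blinfun[of id_blinfun "ket (undefined :: 'a)"] by (simp add: norm_ket)
  qed
  then show "norm (1 :: 'a bop) = 1" by transfer
qed (simp_all add: dist_bop_def sgn_bop_def uniformity_bop_def open_bop_def)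

end

instantiation bop :: (type) complex_normed_vector
begin

lift_definition scaleC_bop :: "complex \<Rightarrow> 'a bop \<Rightarrow> 'a bop" is
  "\<lambda>c x. blinfun_compose (Blinfun (\<lambda>\<xi>. c *\<^sub>C \<xi>)) x"
  by (simp add: bounded_linear_Blinfun_apply[OF bounded_linear_scaleC] scaleC_scaleC mult.commute)

lemma scaleC_bop_apply: "(c *\<^sub>C x) \<cdot> \<xi> = c *\<^sub>C (x \<cdot> \<xi>)"
  by transfer (simp add: bounded_linear_Blinfun_apply[OF bounded_linear_scaleC])

lemma bop_eqI: "(\<And>\<xi>. x \<cdot> \<xi> = y \<cdot> \<xi>) \<Longrightarrow> x = y"
  by transfer (rule blinfun_eqI)

lemma plus_bop_apply: "(x + y) \<cdot> \<xi> = x \<cdot> \<xi> + y \<cdot> \<xi>"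
  by transfer (simp add: blinfun.bilinear_simps)

lemma scaleR_bop_apply: "(r *\<^sub>R x) \<cdot> \<xi> = r *\<^sub>R (x \<cdot> \<xi>)"
  by transfer (simp add: blinfun.bilinear_simps)

lemma norm_bop_apply: "norm (x \<cdot> \<xi>) \<le> norm x * norm \<xi>"
  by transfer (rule norm_blinfun)

instance
proof
  fix a b :: complex and x y :: "'a bop" and r :: real
  show "a *\<^sub>C (x + y) = a *\<^sub>C x + a *\<^sub>C y"
    by (rule bop_eqI) (simp add: scaleC_bop_apply plus_bop_apply scaleC_add_right)
  show "(a + b) *\<^sub>C x = a *\<^sub>C x + b *\<^sub>C x"
    by (rule bop_eqI) (simp add: scaleC_bop_apply plus_bop_apply scaleC_add_left)
  show *: "a *\<^sub>C (b *\<^sub>C x) = (a * b) *\<^sub>C x" for a b and x :: "'a bop"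
    by (rule bop_eqI) (simp add: scaleC_bop_apply scaleC_scaleC)
  show "r *\<^sub>R x = complex_of_real r *\<^sub>C x"
    by (rule bop_eqI) (simp add: scaleC_bop_apply scaleR_bop_apply scaleR_scaleC)
  have le: "norm (a *\<^sub>C x) \<le> cmod a * norm x" for a and x :: "'a bop"
    unfolding norm_bop.rep_eq
    by (rule norm_blinfun_bound)
      (use norm_bop_apply[of x] in \<open>auto simp: norm_scaleC mult.assoc intro!: mult_left_mono
         simp flip: bop_apply.rep_eq norm_bop.rep_eq simp add: scaleC_bop_apply\<close>)
  show "norm (a *\<^sub>C x) = cmod a * norm x"
  proof (cases "a = 0")
    case True
    then show ?thesis using le[of 0 x] by simp
  next
    case False
    have "x = inverse a *\<^sub>C (a *\<^sub>C x)"
      by (rule bop_eqI) (use False in \<open>simp add: scaleC_bop_apply scaleC_scaleC scaleC_one\<close>)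
    then have "norm x \<le> cmod (inverse a) * norm (a *\<^sub>C x)" using le[of "inverse a" "a *\<^sub>C x"] by simp
    then have "cmod a * norm x \<le> norm (a *\<^sub>C x)" using False by (simp only: norm_inverse) (simp add: field_simps)
    then show ?thesis using le[of a x] by simp
  qed
qed

end


lifting_update bop.lifting
lifting_forget bop.lifting


lemma ell2_eqI: "(\<And>x. ell2_coord f x = ell2_coord g x) \<Longrightarrow> f = g"
  by (simp add: fun_eq_iff flip: ell2_coord_inject)

lemma coord_has_sum: "((\<lambda>x. (cmod (ell2_coord \<xi> x))\<^sup>2) has_sum (norm \<xi>)\<^sup>2) UNIV"
  using ell2_coord[of \<xi>] by (simp add: has_sum_infsum norm_ell2_def infsum_nonneg)

lemma cinner_scaleC_left: "cinner (c *\<^sub>C f) g = c * cinner f g"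
  unfolding cinner.rep_eq scaleC_ell2.rep_eq mult.assoc by (rule infsum_cmult_right')

lemma cinner_scaleC_right: "cinner f (c *\<^sub>C g) = cnj c * cinner f g"
  by (subst cinner_commute) (simp add: cinner_scaleC_left flip: cinner_commute)

lemma cinner_add_right: "cinner f (g + h) = cinner f g + cinner f h"
  by (subst cinner_commute) (simp add: cinner_add_left flip: cinner_commute)

lemma cinner_ket_right: "cinner f (ket x) = ell2_coord f x"
proof -
  have "cinner f (ket x) = (\<Sum>\<^sub>\<infinity>y\<in>{x}. ell2_coord f y * cnj (ell2_coord (ket x) y))"
    unfolding cinner.rep_eq by (rule infsum_cong_neutral) (auto simp: ket.rep_eq)
  then show ?thesis by (simp add: ket.rep_eq)
qed

lemma cmod_cinner_le: "cmod (cinner f g) \<le> norm f * norm g"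
proof (cases "cinner f g = 0")
  case False
  define c where "c = cnj (cinner f g) / cmod (cinner f g)"
  have "cmod c = 1" using False by (simp add: c_def norm_divide)
  have "cinner (c *\<^sub>C f) g = complex_of_real (cmod (cinner f g))"
    using False unfolding cinner_scaleC_left c_def
    by (simp add: field_simps complex_norm_square[symmetric] power2_eq_square)
  then have "cmod (cinner f g) = inner (c *\<^sub>C f) g" by (simp add: inner_ell2_def)
  also have "\<dots> \<le> norm (c *\<^sub>C f) * norm g" by (rule norm_cauchy_schwarz)
  finally show ?thesis using \<open>cmod c = 1\<close> by (simp add: norm_scaleC)
qed simp

lemma bounded_linear_cinner_left: "bounded_linear (\<lambda>f. cinner f g)"
proof (rule bounded_linear_intro[where K="norm g"])
  show "cinner (r *\<^sub>R f) g = r *\<^sub>R cinner f g" for r f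
    by (subst scaleR_scaleC) (simp add: cinner_scaleC_left scaleR_conv_of_real)
qed (simp_all add: cinner_add_left cmod_cinner_le)

lemma bounded_linear_bop_apply: "bounded_linear ((\<cdot>) x)"
  unfolding bop_apply.rep_eq by (rule blinfun.bounded_linear_right)

lemma bop_apply_scaleC: "x \<cdot> (c *\<^sub>C \<xi>) = c *\<^sub>C (x \<cdot> \<xi>)"
  using blinfun_of_bop[of x] by (simp add: bop_apply.rep_eq)

lemma coord_sum: "ell2_coord (\<Sum>i\<in>F. g i) y = (\<Sum>i\<in>F. ell2_coord (g i) y)"
  by (induction F rule: infinite_finite_induct) (auto simp: zero_ell2.rep_eq plus_ell2.rep_eq)

lemma ket_expansion: "((\<lambda>i. ell2_coord f i *\<^sub>C ket i) has_sum f) UNIV"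
proof -
  let ?t = "\<lambda>F. \<Sum>i\<in>F. ell2_coord f i *\<^sub>C ket i"
  let ?S = "sum (\<lambda>i. (cmod (ell2_coord f i))\<^sup>2)"
  have norm_diff: "(norm (f - ?t F))\<^sup>2 = (norm f)\<^sup>2 - ?S F" if "finite F" for F
  proof -
    have c: "ell2_coord (?t F) y = (if y \<in> F then ell2_coord f y else 0)" for y
      using that by (simp add: coord_sum scaleC_ell2.rep_eq ket.rep_eq if_distrib cong: if_cong)
    have "((\<lambda>y. (cmod (ell2_coord f y))\<^sup>2) has_sum ?S F) F"
      using that by (rule has_sum_finite)
    then have "((\<lambda>y. (cmod (ell2_coord (?t F) y))\<^sup>2) has_sum ?S F) UNIV"
      by (rule has_sum_cong_neutral[THEN iffD1, rotated -1]) (auto simp: c)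
    from has_sum_add[OF coord_has_sum[of f] has_sum_cmult_right[OF this, of "-1"]]
    have "((\<lambda>y. (cmod (ell2_coord (f - ?t F) y))\<^sup>2) has_sum ((norm f)\<^sup>2 - ?S F)) UNIV"
      by (simp add: c minus_ell2.rep_eq if_distrib[of cmod] if_distrib[of "\<lambda>u. u\<^sup>2"]
          if_distrib[of uminus] if_distrib[of "\<lambda>u. _ - u"] if_distrib[of "\<lambda>u. _ + u"] cong: if_cong)
    from has_sum_unique[OF coord_has_sum this] show ?thesis .
  qed
  have "(?S \<longlongrightarrow> (norm f)\<^sup>2) (finite_subsets_at_top UNIV)"
    using coord_has_sum[of f] by (simp add: has_sum_def)
  then have "((\<lambda>F. sqrt ((norm f)\<^sup>2 - ?S F)) \<longlongrightarrow> sqrt ((norm f)\<^sup>2 - (norm f)\<^sup>2)) (finite_subsets_at_top UNIV)"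
    by (intro tendsto_intros)
  then have "((\<lambda>F. sqrt ((norm f)\<^sup>2 - ?S F)) \<longlongrightarrow> 0) (finite_subsets_at_top UNIV)" by simp
  moreover have "\<forall>\<^sub>F F in finite_subsets_at_top UNIV. norm (?t F - f) = sqrt ((norm f)\<^sup>2 - ?S F)"
    by (rule eventually_finite_subsets_at_top_weakI)
      (simp add: norm_minus_commute flip: norm_diff)
  ultimately have "((\<lambda>F. norm (?t F - f)) \<longlongrightarrow> 0) (finite_subsets_at_top UNIV)"
    by (simp cong: tendsto_cong)
  then show ?thesis
    unfolding has_sum_def by (simp add: tendsto_norm_zero_iff LIM_zero_iff)
qed

text \<open>The inner product is linear in its first argument.\<close>

definition adj :: "'a bop \<Rightarrow> 'a bop" where
  "adj x = (THE y. \<forall>\<xi> \<eta>. cinner (x \<cdot> \<xi>) \<eta> = cinner \<xi> (y \<cdot> \<eta>))"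

lemma adjoint_exists:
  fixes x :: "'a bop"
  shows "\<exists>y. \<forall>\<xi> \<eta>. cinner (x \<cdot> \<xi>) \<eta> = cinner \<xi> (y \<cdot> \<eta>)"
proof -
  define g :: "'a ell2 \<Rightarrow> 'a \<Rightarrow> complex" where "g \<eta> i = cinner \<eta> (x \<cdot> ket i)" for \<eta> i
  have bound: "(\<Sum>i\<in>F. (cmod (g \<eta> i))\<^sup>2) \<le> (norm x * norm \<eta>)\<^sup>2" if "finite F" for F \<eta>
  proof -
    let ?\<zeta> = "\<Sum>i\<in>F. g \<eta> i *\<^sub>C ket i"
    let ?S = "\<Sum>i\<in>F. (cmod (g \<eta> i))\<^sup>2"
    have c: "ell2_coord ?\<zeta> y = (if y \<in> F then g \<eta> y else 0)" for y
      using that by (simp add: coord_sum scaleC_ell2.rep_eq ket.rep_eq if_distrib cong: if_cong)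
    have "((\<lambda>y. (cmod (g \<eta> y))\<^sup>2) has_sum ?S) F"
      using that by (rule has_sum_finite)
    then have "((\<lambda>y. (cmod (ell2_coord ?\<zeta> y))\<^sup>2) has_sum ?S) UNIV"
      by (rule has_sum_cong_neutral[THEN iffD1, rotated -1]) (auto simp: c)
    from has_sum_unique[OF coord_has_sum this] have n: "(norm ?\<zeta>)\<^sup>2 = ?S" .
    interpret X: bounded_linear "(\<cdot>) x" by (rule bounded_linear_bop_apply)
    interpret C: bounded_linear "\<lambda>f. cinner f \<eta>" by (rule bounded_linear_cinner_left)
    have "cinner (x \<cdot> ?\<zeta>) \<eta> = (\<Sum>i\<in>F. g \<eta> i * cnj (g \<eta> i))"
      by (simp add: X.sum C.sum bop_apply_scaleC cinner_scaleC_left g_def flip: cinner_commute)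
    also have "\<dots> = complex_of_real ?S" by (simp flip: complex_norm_square)
    finally have "?S = cmod (cinner (x \<cdot> ?\<zeta>) \<eta>)" by (simp only: norm_of_real) (simp add: sum_nonneg)
    also have "\<dots> \<le> norm (x \<cdot> ?\<zeta>) * norm \<eta>" by (rule cmod_cinner_le)
    also have "\<dots> \<le> (norm x * norm ?\<zeta>) * norm \<eta>" by (intro mult_right_mono norm_bop_apply) simp
    finally have "norm ?\<zeta> * norm ?\<zeta> \<le> norm ?\<zeta> * (norm x * norm \<eta>)"
      by (simp add: mult_ac flip: n) (simp add: power2_eq_square)
    then have "norm ?\<zeta> \<le> norm x * norm \<eta>"
      by (cases "?\<zeta> = 0") auto
    then have "(norm ?\<zeta>)\<^sup>2 \<le> (norm x * norm \<eta>)\<^sup>2" by (intro power_mono) auto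
    then show ?thesis by (simp add: n)
  qed
  have summable: "(\<lambda>i. (cmod (g \<eta> i))\<^sup>2) summable_on UNIV" for \<eta>
    by (rule nonneg_bdd_above_summable_on) (auto intro!: bdd_aboveI2 bound)
  define h where "h \<eta> = Abs_ell2 (g \<eta>)" for \<eta>
  have coord_h: "ell2_coord (h \<eta>) = g \<eta>" for \<eta>
    unfolding h_def using summable by (intro Abs_ell2_inverse) auto
  have scale: "h (c *\<^sub>C \<eta>) = c *\<^sub>C h \<eta>" for c \<eta>
    by (rule ell2_eqI) (simp add: coord_h g_def scaleC_ell2.rep_eq cinner_scaleC_left)
  have "bounded_linear h"
  proof (rule bounded_linear_intro[where K="norm x"])
    show "h (\<eta> + \<eta>') = h \<eta> + h \<eta>'" for \<eta> \<eta>'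
      by (rule ell2_eqI) (simp add: coord_h g_def plus_ell2.rep_eq cinner_add_left)
    show "h (r *\<^sub>R \<eta>) = r *\<^sub>R h \<eta>" for r \<eta>
      by (simp add: scaleR_scaleC scale)
    fix \<eta>
    have "(norm (h \<eta>))\<^sup>2 = (\<Sum>\<^sub>\<infinity>i. (cmod (g \<eta> i))\<^sup>2)"
      using infsumI[OF coord_has_sum[of "h \<eta>"]] by (simp add: coord_h)
    also have "\<dots> \<le> (norm x * norm \<eta>)\<^sup>2"
      by (rule infsum_le_finite_sums[OF summable]) (auto intro: bound)
    finally show "norm (h \<eta>) \<le> norm \<eta> * norm x"
      by (simp add: abs_le_square_iff[symmetric] mult.commute)
  qed
  then have apply_y: "Abs_bop (Blinfun h) \<cdot> \<eta> = h \<eta>" for \<eta>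
    by (simp add: bop_apply.rep_eq Abs_bop_inverse bounded_linear_Blinfun_apply scale)
  have "cinner (x \<cdot> \<xi>) \<eta> = cinner \<xi> (h \<eta>)" for \<xi> \<eta>
  proof -
    have "bounded_linear (\<lambda>\<xi>. cinner (x \<cdot> \<xi>) \<eta>)"
      by (rule bounded_linear_compose[OF bounded_linear_cinner_left bounded_linear_bop_apply])
    from has_sum_bounded_linear[OF this ket_expansion[of \<xi>]]
    have "((\<lambda>i. cinner (x \<cdot> (ell2_coord \<xi> i *\<^sub>C ket i)) \<eta>) has_sum cinner (x \<cdot> \<xi>) \<eta>) UNIV"
      by (simp add: o_def)
    then have 1: "((\<lambda>i. ell2_coord \<xi> i * cinner (x \<cdot> ket i) \<eta>) has_sum cinner (x \<cdot> \<xi>) \<eta>) UNIV"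
      by (simp add: bop_apply_scaleC cinner_scaleC_left)
    have "cinner (x \<cdot> ket i) \<eta> = cnj (g \<eta> i)" for i
      unfolding g_def by (rule cinner_commute)
    with infsumI[OF 1] show ?thesis
      unfolding cinner.rep_eq[of \<xi>] coord_h by simp
  qed
  then show ?thesis using apply_y by (intro exI[of _ "Abs_bop (Blinfun h)"]) simp
qed

lemma cinner_adj: "cinner (x \<cdot> \<xi>) \<eta> = cinner \<xi> (adj x \<cdot> \<eta>)"
proof -
  have "\<exists>!y. \<forall>\<xi> \<eta>. cinner (x \<cdot> \<xi>) \<eta> = cinner \<xi> (y \<cdot> \<eta>)"
  proof (rule ex_ex1I[OF adjoint_exists])
    fix y z assume *: "\<forall>\<xi> \<eta>. cinner (x \<cdot> \<xi>) \<eta> = cinner \<xi> (y \<cdot> \<eta>)"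
      "\<forall>\<xi> \<eta>. cinner (x \<cdot> \<xi>) \<eta> = cinner \<xi> (z \<cdot> \<eta>)"
    show "y = z"
    proof (intro bop_eqI ell2_eqI)
      fix \<eta> i
      have "cinner (ket i) (y \<cdot> \<eta>) = cinner (ket i) (z \<cdot> \<eta>)" using * by metis
      then show "ell2_coord (y \<cdot> \<eta>) i = ell2_coord (z \<cdot> \<eta>) i"
        by (metis cinner_commute cinner_ket_right)
    qed
  qed
  from theI'[OF this] show ?thesis unfolding adj_def by blast
qed


section \<open>Concrete C*-algebras and their dynamics\<close>

definition complex_subspace :: "'v :: complex_normed_vector set \<Rightarrow> bool" where
  "complex_subspace V \<longleftrightarrow> 0 \<in> V \<and> (\<forall>x\<in>V. \<forall>y\<in>V. x + y \<in> V) \<and> (\<forall>c. \<forall>x\<in>V. c *\<^sub>C x \<in> V)"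

definition cstar_subalgebra :: "'a bop set \<Rightarrow> bool" where
  "cstar_subalgebra A \<longleftrightarrow> complex_subspace A \<and> closed A \<and>
     (\<forall>x\<in>A. \<forall>y\<in>A. x * y \<in> A) \<and> (\<forall>x\<in>A. adj x \<in> A)"

definition cstar_generated :: "'a bop set \<Rightarrow> 'a bop set" where
  "cstar_generated X = cstar_subalgebra hull X"

definition closed_ideal :: "'a bop set \<Rightarrow> 'a bop set \<Rightarrow> bool" where
  "closed_ideal A J \<longleftrightarrow> J \<subseteq> A \<and> complex_subspace J \<and> closed J \<and>
     (\<forall>x\<in>A. \<forall>j\<in>J. x * j \<in> J \<and> j * x \<in> J)"

definition ideal_generated :: "'a bop set \<Rightarrow> 'a bop set \<Rightarrow> 'a bop set" where
  "ideal_generated A X = closed_ideal A hull X"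

definition quotient_map :: "'a bop set \<Rightarrow> 'a bop \<Rightarrow> 'a bop set" where
  "quotient_map J x = {x + j | j. j \<in> J}"

definition star_automorphism :: "'a bop set \<Rightarrow> ('a bop \<Rightarrow> 'a bop) \<Rightarrow> bool" where
  "star_automorphism A \<alpha> \<longleftrightarrow> bij_betw \<alpha> A A \<and>
     (\<forall>x\<in>A. \<forall>y\<in>A. \<alpha> (x + y) = \<alpha> x + \<alpha> y) \<and>
     (\<forall>c. \<forall>x\<in>A. \<alpha> (c *\<^sub>C x) = c *\<^sub>C \<alpha> x) \<and>
     (\<forall>x\<in>A. \<forall>y\<in>A. \<alpha> (x * y) = \<alpha> x * \<alpha> y) \<and>
     (\<forall>x\<in>A. \<alpha> (adj x) = adj (\<alpha> x))"

definition dynamical_system :: "'a bop set \<Rightarrow> (real \<Rightarrow> 'a bop \<Rightarrow> 'a bop) \<Rightarrow> bool" where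
  "dynamical_system A \<sigma> \<longleftrightarrow> (\<forall>t. star_automorphism A (\<sigma> t)) \<and>
     (\<forall>t u. \<forall>x\<in>A. \<sigma> (t + u) x = \<sigma> t (\<sigma> u x)) \<and>
     (\<forall>x\<in>A. continuous_on UNIV (\<lambda>t. \<sigma> t x))"

text \<open>
  Linear functionals on \<open>A\<close> are functions on all operators of which only the values on \<open>A\<close> matter.
  The notion of state is the one for algebras containing the identity operator.
\<close>

definition state :: "'a bop set \<Rightarrow> ('a bop \<Rightarrow> complex) \<Rightarrow> bool" where
  "state A \<phi> \<longleftrightarrow> (\<forall>x\<in>A. \<forall>y\<in>A. \<phi> (x + y) = \<phi> x + \<phi> y) \<and>
     (\<forall>c. \<forall>x\<in>A. \<phi> (c *\<^sub>C x) = c * \<phi> x) \<and>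
     (\<forall>x\<in>A. \<phi> (adj x * x) \<in> \<real>\<^sub>\<ge>\<^sub>0) \<and> \<phi> 1 = 1"

text \<open>
  \<open>entire_orbit A \<sigma> c F\<close>: the map \<open>F\<close> is the entire extension \<open>z \<mapsto> \<sigma>\<^sub>z(c)\<close> of the orbit of \<open>c\<close>
  (unique, by the identity theorem); differentiability is complex differentiability in norm.
\<close>

definition entire_orbit ::
    "'a bop set \<Rightarrow> (real \<Rightarrow> 'a bop \<Rightarrow> 'a bop) \<Rightarrow> 'a bop \<Rightarrow> (complex \<Rightarrow> 'a bop) \<Rightarrow> bool" where
  "entire_orbit A \<sigma> c F \<longleftrightarrow> range F \<subseteq> A \<and>
     (\<forall>z. \<exists>D. (F has_derivative (\<lambda>h. h *\<^sub>C D)) (at z)) \<and>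
     (\<forall>t. F (complex_of_real t) = \<sigma> t c)"

definition analytic_element :: "'a bop set \<Rightarrow> (real \<Rightarrow> 'a bop \<Rightarrow> 'a bop) \<Rightarrow> 'a bop \<Rightarrow> bool" where
  "analytic_element A \<sigma> c \<longleftrightarrow> c \<in> A \<and> (\<exists>F. entire_orbit A \<sigma> c F)"

definition kms_state ::
    "'a bop set \<Rightarrow> (real \<Rightarrow> 'a bop \<Rightarrow> 'a bop) \<Rightarrow> real \<Rightarrow> ('a bop \<Rightarrow> complex) \<Rightarrow> bool" where
  "kms_state A \<sigma> \<beta> \<phi> \<longleftrightarrow> state A \<phi> \<and>
     (\<forall>c d F. analytic_element A \<sigma> c \<longrightarrow> analytic_element A \<sigma> d \<longrightarrow> entire_orbit A \<sigma> c F \<longrightarrow>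
        \<phi> (c * d) = \<phi> (d * F (\<i> * complex_of_real \<beta>))) \<and>
     (\<beta> = 0 \<longrightarrow> (\<forall>t. \<forall>x\<in>A. \<phi> (\<sigma> t x) = \<phi> x))"

text \<open>
  Weak* limits of nets of KMS states whose inverse temperatures tend to infinity, a net of pairs
  \<open>(\<beta>, \<psi>)\<close> being represented by its tail filter.
\<close>

definition kms_infinity_state ::
    "'a bop set \<Rightarrow> (real \<Rightarrow> 'a bop \<Rightarrow> 'a bop) \<Rightarrow> ('a bop \<Rightarrow> complex) \<Rightarrow> bool" where
  "kms_infinity_state A \<sigma> \<phi> \<longleftrightarrow> state A \<phi> \<and>
     (\<exists>\<F> :: (real \<times> ('a bop \<Rightarrow> complex)) filter. \<F> \<noteq> bot \<and>
        (\<forall>\<^sub>F (\<beta>, \<psi>) in \<F>. kms_state A \<sigma> \<beta> \<psi>) \<and>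
        filterlim fst at_top \<F> \<and>
        (\<forall>x\<in>A. ((\<lambda>(\<beta>, \<psi>). \<psi> x) \<longlongrightarrow> \<phi> x) \<F>))"

definition ground_state ::
    "'a bop set \<Rightarrow> (real \<Rightarrow> 'a bop \<Rightarrow> 'a bop) \<Rightarrow> ('a bop \<Rightarrow> complex) \<Rightarrow> bool" where
  "ground_state A \<sigma> \<phi> \<longleftrightarrow> state A \<phi> \<and>
     (\<forall>c d F. analytic_element A \<sigma> c \<longrightarrow> analytic_element A \<sigma> d \<longrightarrow> entire_orbit A \<sigma> d F \<longrightarrow>
        bounded ((\<lambda>z. \<phi> (c * F z)) ` {z. Im z > 0}))"

text \<open>
  The map \<open>q\<close> sends \<open>A\<close> onto the quotient. As \<open>q\<close> is then a surjective *-homomorphism, the functional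
  \<open>\<psi>\<close> below is unique on \<open>q ` A\<close>, and is automatically a state there when \<open>\<phi>\<close> is one.
\<close>

definition factors_through ::
    "'a bop set \<Rightarrow> ('a bop \<Rightarrow> 'q) \<Rightarrow> ('a bop \<Rightarrow> complex) \<Rightarrow> bool" where
  "factors_through A q \<phi> \<longleftrightarrow> (\<exists>\<psi> :: 'q \<Rightarrow> complex. \<forall>x\<in>A. \<phi> x = \<psi> (q x))"


section \<open>The Toeplitz algebra of the affine semigroup over the natural numbers\<close>

typedef affine_nat = "{x :: nat \<times> nat. snd x \<noteq> 0}"
  morphisms affine_pair affine
  by (rule exI[of _ "(0, 1)"]) simp

setup_lifting type_definition_affine_nat

instantiation affine_nat :: monoid_mult
begin

lift_definition one_affine_nat :: affine_nat is "(0, 1)" by simp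
lift_definition times_affine_nat :: "affine_nat \<Rightarrow> affine_nat \<Rightarrow> affine_nat" is
  "\<lambda>(m, a) (n, b). (m + a * n, a * b)" by auto

instance
  by standard (transfer; auto simp: algebra_simps)+

end

lemma affine_mult:
  assumes "a \<noteq> 0" "b \<noteq> 0"
  shows "affine (m, a) * affine (n, b) = affine (m + a * n, a * b)"
  using assms by (simp add: times_affine_nat_def affine_inverse)

lemma inj_affine_mult: "inj ((*) (x :: affine_nat))"
  by (rule injI, transfer) auto

lemma shift_has_sum:
  fixes f :: "affine_nat \<Rightarrow> complex"
  assumes "((\<lambda>x. (cmod (f x))\<^sup>2) has_sum S) UNIV"
  shows "((\<lambda>x. (cmod (if x \<in> range ((*) y) then f (inv ((*) y) x) else 0))\<^sup>2) has_sum S) UNIV"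
proof -
  let ?g = "\<lambda>x. (cmod (if x \<in> range ((*) y) then f (inv ((*) y) x) else 0))\<^sup>2"
  have "(?g \<circ> (*) y has_sum S) UNIV"
    using assms by (simp add: o_def inv_f_f[OF inj_affine_mult])
  then have "(?g has_sum S) (range ((*) y))"
    by (subst has_sum_reindex[OF inj_affine_mult])
  then show ?thesis
    by (rule has_sum_cong_neutral[THEN iffD1, rotated -1]) auto
qed

definition shift_vec :: "affine_nat \<Rightarrow> affine_nat ell2 \<Rightarrow> affine_nat ell2" where
  "shift_vec y \<xi> =
     Abs_ell2 (\<lambda>x. if x \<in> range ((*) y) then ell2_coord \<xi> (inv ((*) y) x) else 0)"

lemma coord_shift_vec:
  "ell2_coord (shift_vec y \<xi>) =
     (\<lambda>x. if x \<in> range ((*) y) then ell2_coord \<xi> (inv ((*) y) x) else 0)"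
  unfolding shift_vec_def
  by (rule Abs_ell2_inverse)
    (use shift_has_sum[OF coord_has_sum, of y \<xi>] in \<open>auto intro: has_sum_imp_summable\<close>)

lemma bounded_linear_shift_vec: "bounded_linear (shift_vec y)"
proof (rule bounded_linear_intro[where K=1])
  fix \<xi> \<eta> :: "affine_nat ell2" and r :: real
  show "shift_vec y (\<xi> + \<eta>) = shift_vec y \<xi> + shift_vec y \<eta>"
    by (rule ell2_eqI) (simp add: coord_shift_vec plus_ell2.rep_eq)
  show "shift_vec y (r *\<^sub>R \<xi>) = r *\<^sub>R shift_vec y \<xi>"
    by (rule ell2_eqI) (simp add: coord_shift_vec scaleR_ell2.rep_eq)
  show "norm (shift_vec y \<xi>) \<le> norm \<xi> * 1"
    using has_sum_unique[OF coord_has_sum[of "shift_vec y \<xi>", unfolded coord_shift_vec]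
        shift_has_sum[OF coord_has_sum, of y \<xi>]]
    by simp
qed

definition toeplitz_isometry :: "affine_nat \<Rightarrow> affine_nat bop" where
  "toeplitz_isometry y = Abs_bop (Blinfun (shift_vec y))"

lemma toeplitz_isometry_apply: "toeplitz_isometry y \<cdot> \<xi> = shift_vec y \<xi>"
proof -
  have "shift_vec y (c *\<^sub>C \<xi>) = c *\<^sub>C shift_vec y \<xi>" for c \<xi>
    by (rule ell2_eqI) (simp add: coord_shift_vec scaleC_ell2.rep_eq)
  then show ?thesis
    by (simp add: toeplitz_isometry_def bop_apply.rep_eq Abs_bop_inverse
        bounded_linear_Blinfun_apply[OF bounded_linear_shift_vec])
qed

lemma toeplitz_isometry_ket: "toeplitz_isometry y \<cdot> ket x = ket (y * x)"
  by (rule ell2_eqI)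
    (auto simp: toeplitz_isometry_apply coord_shift_vec ket.rep_eq inv_f_f[OF inj_affine_mult]
      dest: injD[OF inj_affine_mult])

definition toeplitz_algebra :: "affine_nat bop set" where
  "toeplitz_algebra = cstar_generated (range toeplitz_isometry)"

definition gen_s :: "affine_nat bop" where
  "gen_s = toeplitz_isometry (affine (1, 1))"

definition gen_v :: "nat \<Rightarrow> affine_nat bop" where
  "gen_v p = toeplitz_isometry (affine (0, p))"

definition q_add :: "affine_nat bop \<Rightarrow> affine_nat bop set" where
  "q_add = quotient_map (ideal_generated toeplitz_algebra {1 - gen_s * adj gen_s})"

text \<open>
  Such an action exists: conjugation by the diagonal unitaries
  \<open>ket (affine (m, a)) \<mapsto> a\<^sup>i\<^sup>t *\<^sub>C ket (affine (m, a))\<close>.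
\<close>

definition toeplitz_dynamics :: "(real \<Rightarrow> affine_nat bop \<Rightarrow> affine_nat bop) \<Rightarrow> bool" where
  "toeplitz_dynamics \<sigma> \<longleftrightarrow> dynamical_system toeplitz_algebra \<sigma> \<and>
     (\<forall>t. \<sigma> t gen_s = gen_s) \<and>
     (\<forall>t p. prime p \<longrightarrow> \<sigma> t (gen_v p) = (of_nat p powr (\<i> * complex_of_real t)) *\<^sub>C gen_v p)"

end

(*
  A KMS state gives 1 - s s* the value 0, because s is fixed by the dynamics. By the Cauchy-Schwarz
  inequality and the KMS condition it then vanishes on the ideal generated by 1 - s s*, and this
  property survives weak* limits.

  Conversely, a ground state \<phi> vanishes on c d whenever d is homogeneous of negative degree. If it
  also factors through the additive quotient, then \<phi> (s y) = \<phi> (y s) for all y. For large \<beta> the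
  normalised sum of a^(-\<beta>) \<phi> (T_z* x T_z) over z = (r, a), 0 \<le> r < a, is a KMS state: commutation
  with s is the cyclic shift of r, and commutation with v_b reindexes the sum by z \<mapsto> (0, b) z. As
  \<beta> \<rightarrow> \<infinity> only the term z = (0, 1) survives, so these states converge to \<phi>.
*)
theory Submission
  imports Defs "HOL-Complex_Analysis.Complex_Analysis"
begin

section \<open>Operators and adjoints\<close>

text \<open>States carry no continuity assumption, and the KMS condition ranges over all analytic
  elements and their entire orbits, whereas computations are only possible on the isometries. Two
  devices bridge this gap. Positivity makes states bounded, through square roots of 1 - h inside the
  algebra; hence the work on completeness. And two principal right ideals of the affine semigroup
  are disjoint or meet in a principal one, so the words
  \<open>toeplitz_isometry x * adj (toeplitz_isometry y)\<close> span a dense subspace. The dynamics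
  multiplies each word by a scalar, and identities are checked on words, one variable at a time.

  The pairs (r, a) with r < a arise from induction: (r, a)(k, 1) = (r + a k, a), so they represent
  the semigroup modulo right multiplication by its additive part. A ground state vanishes on every
  word outside the C*-algebra of s, and s becomes unitary in the quotient; this yields the
  commutation with s, which the wrap-around of the cyclic shift requires. Each a has a residues, so
  the normalising constant is the sum of a^(1 - \<beta>), finite for \<beta> > 2; the range \<beta>
  \<ge> 3 is used.\<close>

lemma times_bop_apply: "(x * y) \<cdot> \<xi> = x \<cdot> (y \<cdot> \<xi>)"
  by (simp add: bop_apply.rep_eq times_bop.rep_eq)

lemma one_bop_apply: "1 \<cdot> \<xi> = \<xi>"
  by (simp add: bop_apply.rep_eq one_bop.rep_eq)

text \<open>The kets span a dense subspace, by \<open>ket_expansion\<close>. Relations among the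
  isometries thereby turn into equations in the semigroup.\<close>

lemma bop_eq_matrixI:
  assumes "\<And>i j. cinner (x \<cdot> ket i) (ket j) = cinner (y \<cdot> ket i) (ket j)"
  shows "x = y"
proof (rule bop_eqI)
  fix \<xi>
  have expand: "((\<lambda>i. z \<cdot> (ell2_coord \<xi> i *\<^sub>C ket i)) has_sum z \<cdot> \<xi>) UNIV" for z :: "'a bop"
    using has_sum_bounded_linear[OF bounded_linear_bop_apply[of z] ket_expansion[of \<xi>]] by (simp add: o_def)
  have "x \<cdot> ket i = y \<cdot> ket i" for i
    using assms[of i] by (intro ell2_eqI) (simp add: cinner_ket_right)
  then show "x \<cdot> \<xi> = y \<cdot> \<xi>"
    using has_sum_unique[OF expand[of x]] expand[of y] by (simp add: bop_apply_scaleC)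
qed

lemma norm_bop_le:
  assumes "0 \<le> K" "\<And>\<xi>. norm (x \<cdot> \<xi>) \<le> K * norm \<xi>"
  shows "norm (x :: 'a bop) \<le> K"
  unfolding norm_bop.rep_eq
  by (rule norm_blinfun_bound) (use assms in \<open>simp_all add: bop_apply.rep_eq\<close>)

lemma scaleC_mult_left: "(c *\<^sub>C x) * (y :: 'a bop) = c *\<^sub>C (x * y)"
  by (rule bop_eqI) (simp add: times_bop_apply scaleC_bop_apply)

lemma scaleC_mult_right: "(x :: 'a bop) * (c *\<^sub>C y) = c *\<^sub>C (x * y)"
  by (rule bop_eqI) (simp add: times_bop_apply scaleC_bop_apply bop_apply_scaleC)

lemma scaleC_neg_one: "(- 1) *\<^sub>C (x :: 'a :: complex_normed_vector) = - x"
  using scaleR_scaleC[of "- 1" x] by simp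

lemma cinner_self_norm: "cinner f f = complex_of_real ((norm f)\<^sup>2)"
  using infsumI[OF coord_has_sum[of f]] by (simp add: cinner_self)

lemma adj_eqI:
  assumes "\<And>\<xi> \<eta>. cinner (x \<cdot> \<xi>) \<eta> = cinner \<xi> (y \<cdot> \<eta>)"
  shows "adj x = y"
proof (intro bop_eqI ell2_eqI)
  fix \<eta> i
  have "cinner (ket i) (adj x \<cdot> \<eta>) = cinner (ket i) (y \<cdot> \<eta>)"
    using assms by (simp flip: cinner_adj)
  then show "ell2_coord (adj x \<cdot> \<eta>) i = ell2_coord (y \<cdot> \<eta>) i"
    by (metis cinner_commute cinner_ket_right)
qed

lemma cinner_adj': "cinner (adj x \<cdot> \<xi>) \<eta> = cinner \<xi> (x \<cdot> \<eta>)"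
  by (metis cinner_adj cinner_commute)

lemma adj_adj [simp]: "adj (adj x) = x"
  by (rule adj_eqI) (rule cinner_adj')

lemma adj_mult: "adj (x * y) = adj y * adj x"
  by (rule adj_eqI) (simp add: times_bop_apply cinner_adj)

lemma adj_add: "adj (x + y) = adj x + adj y"
  by (rule adj_eqI) (simp add: plus_bop_apply cinner_adj cinner_add_left cinner_add_right)

lemma adj_scaleC: "adj (c *\<^sub>C x) = cnj c *\<^sub>C adj x"
  by (rule adj_eqI) (simp add: scaleC_bop_apply cinner_adj cinner_scaleC_left cinner_scaleC_right)

lemma adj_one [simp]: "adj 1 = 1"
  by (rule adj_eqI) (simp add: one_bop_apply)

lemma adj_scaleR: "adj (r *\<^sub>R x) = r *\<^sub>R adj x"
  by (simp add: scaleR_scaleC adj_scaleC)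

lemma adj_diff: "adj (x - y) = adj x - adj y"
  using adj_add[of x "- 1 *\<^sub>C y"] by (simp only: adj_scaleC) (simp add: scaleC_neg_one)

lemma adj_power: "adj (x ^ n) = adj x ^ n"
  by (induction n) (simp_all add: adj_mult power_commutes)

lemma norm_adj_le: "norm (adj x) \<le> norm x"
proof (rule norm_bop_le)
  fix \<eta>
  have "(norm (adj x \<cdot> \<eta>))\<^sup>2 = cmod (cinner (x \<cdot> (adj x \<cdot> \<eta>)) \<eta>)"
    by (simp add: cinner_adj cinner_self_norm del: of_real_power)
  also have "\<dots> \<le> norm (x \<cdot> (adj x \<cdot> \<eta>)) * norm \<eta>" by (rule cmod_cinner_le)
  also have "\<dots> \<le> (norm x * norm (adj x \<cdot> \<eta>)) * norm \<eta>"
    by (intro mult_right_mono norm_bop_apply) simp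
  finally show "norm (adj x \<cdot> \<eta>) \<le> norm x * norm \<eta>"
    by (cases "adj x \<cdot> \<eta> = 0") (auto simp: power2_eq_square mult_ac)
qed simp

lemma bounded_linear_adj: "bounded_linear adj"
  by (rule bounded_linear_intro[where K=1]) (simp_all add: adj_add adj_scaleR norm_adj_le)

lemma norm_adj_mult_self_le: "norm (adj x * x) \<le> (norm x)\<^sup>2"
  using norm_mult_ineq[of "adj x" x] mult_right_mono[OF norm_adj_le[of x], of "norm x"]
  by (simp add: power2_eq_square)

lemma bounded_linear_scaleC_left: "bounded_linear (\<lambda>c. c *\<^sub>C (x :: 'a :: complex_normed_vector))"
proof (rule bounded_linear_intro[where K="norm x"])
  show "(r *\<^sub>R c) *\<^sub>C x = r *\<^sub>R (c *\<^sub>C x)" for r c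
    by (simp add: scaleR_scaleC scaleC_scaleC scaleR_conv_of_real)
qed (simp_all add: scaleC_add_left norm_scaleC)


section \<open>Completeness\<close>

lemma sum_cmod_ell2_coord_le:
  assumes "finite F"
  shows "(\<Sum>i\<in>F. (cmod (ell2_coord f i))\<^sup>2) \<le> (norm f)\<^sup>2"
  using finite_sum_le_has_sum[OF coord_has_sum assms] by simp

text \<open>The limit is formed coordinatewise; bounds over finite index sets, uniform in the set,
  then give square summability and convergence in norm. Completeness makes the operator series for
  square roots converge.\<close>

instance ell2 :: (type) banach
proof
  fix X :: "nat \<Rightarrow> 'a ell2"
  assume X: "Cauchy X"
  have "\<exists>l. (\<lambda>n. ell2_coord (X n) i) \<longlonglongrightarrow> l" for i
  proof -
    have "Cauchy (\<lambda>n. cinner (X n) (ket i))"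
      by (rule bounded_linear.Cauchy[OF bounded_linear_cinner_left X])
    then show ?thesis
      by (auto simp: cinner_ket_right Cauchy_convergent_iff convergent_def)
  qed
  then obtain l where l: "(\<lambda>n. ell2_coord (X n) i) \<longlonglongrightarrow> l i" for i by metis
  have tail: "\<exists>N. \<forall>n\<ge>N. \<forall>F. finite F \<longrightarrow> (\<Sum>i\<in>F. (cmod (l i - ell2_coord (X n) i))\<^sup>2) \<le> e\<^sup>2"
    if e: "0 < e" for e
  proof -
    obtain N where N: "norm (X m - X n) < e" if "m \<ge> N" "n \<ge> N" for m n
      using X e unfolding Cauchy_iff by blast
    have "(\<Sum>i\<in>F. (cmod (l i - ell2_coord (X n) i))\<^sup>2) \<le> e\<^sup>2" if n: "n \<ge> N" and F: "finite F" for n F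
    proof (rule LIMSEQ_le_const2)
      show "(\<lambda>m. \<Sum>i\<in>F. (cmod (ell2_coord (X m) i - ell2_coord (X n) i))\<^sup>2)
              \<longlonglongrightarrow> (\<Sum>i\<in>F. (cmod (l i - ell2_coord (X n) i))\<^sup>2)"
        by (intro tendsto_intros l)
      have "(\<Sum>i\<in>F. (cmod (ell2_coord (X m) i - ell2_coord (X n) i))\<^sup>2) \<le> e\<^sup>2" if "m \<ge> N" for m
      proof -
        have "(\<Sum>i\<in>F. (cmod (ell2_coord (X m) i - ell2_coord (X n) i))\<^sup>2) \<le> (norm (X m - X n))\<^sup>2"
          using sum_cmod_ell2_coord_le[OF F, of "X m - X n"] by (simp add: minus_ell2.rep_eq)
        also have "\<dots> \<le> e\<^sup>2" using N[OF that n] by (intro power_mono) auto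
        finally show ?thesis .
      qed
      then show "\<exists>M. \<forall>m\<ge>M. (\<Sum>i\<in>F. (cmod (ell2_coord (X m) i - ell2_coord (X n) i))\<^sup>2) \<le> e\<^sup>2" by blast
    qed
    then show ?thesis by blast
  qed
  have summable: "(\<lambda>i. (cmod (l i - ell2_coord (X n) i))\<^sup>2) summable_on UNIV"
    if "\<And>F. finite F \<Longrightarrow> (\<Sum>i\<in>F. (cmod (l i - ell2_coord (X n) i))\<^sup>2) \<le> e\<^sup>2" for n e
    by (rule nonneg_bdd_above_summable_on) (auto intro!: bdd_aboveI2 that)
  obtain N where "\<And>F. finite F \<Longrightarrow> (\<Sum>i\<in>F. (cmod (l i - ell2_coord (X N) i))\<^sup>2) \<le> 1\<^sup>2"
    using tail[of 1] by auto
  from square_summable_add[OF summable[OF this], of "ell2_coord (X N)"] ell2_coord[of "X N"]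
  have "(\<lambda>i. (cmod (l i))\<^sup>2) summable_on UNIV" by simp
  then have coord_L: "ell2_coord (Abs_ell2 l) = l" by (intro Abs_ell2_inverse) simp
  have "X \<longlonglongrightarrow> Abs_ell2 l"
  proof (rule LIMSEQ_I)
    fix e :: real assume "0 < e"
    then obtain N where N: "\<And>n F. n \<ge> N \<Longrightarrow> finite F \<Longrightarrow>
        (\<Sum>i\<in>F. (cmod (l i - ell2_coord (X n) i))\<^sup>2) \<le> (e/2)\<^sup>2"
      using tail[of "e/2"] by auto
    have "norm (X n - Abs_ell2 l) < e" if n: "n \<ge> N" for n
    proof -
      have "(norm (Abs_ell2 l - X n))\<^sup>2 = (\<Sum>\<^sub>\<infinity>i. (cmod (l i - ell2_coord (X n) i))\<^sup>2)"
        using infsumI[OF coord_has_sum[of "Abs_ell2 l - X n"]] by (simp add: minus_ell2.rep_eq coord_L)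
      also have "\<dots> \<le> (e/2)\<^sup>2"
        by (rule infsum_le_finite_sums[OF summable[OF N[OF n]]]) (auto intro: N[OF n])
      finally have "norm (Abs_ell2 l - X n) \<le> e/2"
        using \<open>0 < e\<close> by (simp add: abs_le_square_iff[symmetric])
      then show ?thesis using \<open>0 < e\<close> by (simp add: norm_minus_commute)
    qed
    then show "\<exists>N. \<forall>n\<ge>N. norm (X n - Abs_ell2 l) < e" by blast
  qed
  then show "convergent X" by (auto simp: convergent_def)
qed

instance bop :: (type) banach
proof
  fix X :: "nat \<Rightarrow> 'a bop"
  assume "Cauchy X"
  then have "Cauchy (\<lambda>n. blinfun_of_bop (X n))"
    unfolding Cauchy_iff by (simp add: norm_bop.rep_eq minus_bop.rep_eq)
  then obtain L where L: "(\<lambda>n. blinfun_of_bop (X n)) \<longlonglongrightarrow> L"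
    by (auto simp: Cauchy_convergent_iff convergent_def)
  have "L (c *\<^sub>C \<xi>) = c *\<^sub>C L \<xi>" for c \<xi>
  proof (rule LIMSEQ_unique)
    have app: "(\<lambda>n. X n \<cdot> \<eta>) \<longlonglongrightarrow> L \<eta>" for \<eta>
      unfolding bop_apply.rep_eq by (intro tendsto_intros L)
    show "(\<lambda>n. X n \<cdot> (c *\<^sub>C \<xi>)) \<longlonglongrightarrow> L (c *\<^sub>C \<xi>)" by (rule app)
    show "(\<lambda>n. X n \<cdot> (c *\<^sub>C \<xi>)) \<longlonglongrightarrow> c *\<^sub>C L \<xi>"
      unfolding bop_apply_scaleC
      by (rule bounded_linear.tendsto[OF bounded_linear_scaleC app])
  qed
  then have "blinfun_of_bop (Abs_bop L) = L" by (intro Abs_bop_inverse) simp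
  then have "X \<longlonglongrightarrow> Abs_bop L"
    using L unfolding LIMSEQ_iff by (simp add: norm_bop.rep_eq minus_bop.rep_eq)
  then show "convergent X" by (auto simp: convergent_def)
qed


section \<open>States on unital C*-algebras\<close>

text \<open>Relative to \<open>A\<close>, since a functional takes arbitrary values outside it.
  Besides states, the notion covers maps such as \<open>x \<mapsto> f (a * x * b)\<close>, which
  need not be positive.\<close>

definition bounded_functional :: "'a bop set \<Rightarrow> ('a bop \<Rightarrow> complex) \<Rightarrow> bool" where
  "bounded_functional A f \<longleftrightarrow> (\<forall>x\<in>A. \<forall>y\<in>A. f (x + y) = f x + f y) \<and>
     (\<forall>c. \<forall>x\<in>A. f (c *\<^sub>C x) = c * f x) \<and> (\<exists>K. \<forall>x\<in>A. cmod (f x) \<le> K * norm x)"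

lemma bounded_functionalI:
  assumes "\<And>x y. x \<in> A \<Longrightarrow> y \<in> A \<Longrightarrow> f (x + y) = f x + f y"
    and "\<And>c x. x \<in> A \<Longrightarrow> f (c *\<^sub>C x) = c * f x"
    and "\<And>x. x \<in> A \<Longrightarrow> cmod (f x) \<le> K * norm x"
  shows "bounded_functional A f"
  using assms unfolding bounded_functional_def by blast

lemma bounded_functional_bound:
  assumes "bounded_functional A f"
  obtains K where "0 \<le> K" "\<And>x. x \<in> A \<Longrightarrow> cmod (f x) \<le> K * norm x"
proof -
  obtain K where K: "\<forall>x\<in>A. cmod (f x) \<le> K * norm x"
    using assms unfolding bounded_functional_def by blast
  show thesis
  proof (rule that[of "max K 0"])
    fix x assume "x \<in> A"
    then have "cmod (f x) \<le> K * norm x" using K by blast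
    also have "\<dots> \<le> max K 0 * norm x" by (intro mult_right_mono) auto
    finally show "cmod (f x) \<le> max K 0 * norm x" .
  qed simp
qed

lemma bounded_functional_add:
  "bounded_functional A f \<Longrightarrow> x \<in> A \<Longrightarrow> y \<in> A \<Longrightarrow> f (x + y) = f x + f y"
  by (simp add: bounded_functional_def)

lemma bounded_functional_scaleC: "bounded_functional A f \<Longrightarrow> x \<in> A \<Longrightarrow> f (c *\<^sub>C x) = c * f x"
  by (simp add: bounded_functional_def)

lemma bounded_functional_const_zero: "bounded_functional A (\<lambda>_. 0)"
  by (rule bounded_functionalI[where K=0]) auto

lemma bounded_functional_diff:
  assumes f: "bounded_functional A f" and g: "bounded_functional A g"
  shows "bounded_functional A (\<lambda>x. f x - g x)"
proof -
  obtain K where K: "0 \<le> K" "\<And>x. x \<in> A \<Longrightarrow> cmod (f x) \<le> K * norm x"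
    by (rule bounded_functional_bound[OF f]) blast
  obtain K' where K': "0 \<le> K'" "\<And>x. x \<in> A \<Longrightarrow> cmod (g x) \<le> K' * norm x"
    by (rule bounded_functional_bound[OF g]) blast
  show ?thesis
  proof (rule bounded_functionalI[where K="K + K'"])
    show "cmod (f x - g x) \<le> (K + K') * norm x" if "x \<in> A" for x
      using norm_triangle_ineq4[of "f x" "g x"] K(2)[OF that] K'(2)[OF that]
      by (simp add: algebra_simps)
  qed (use f g in \<open>auto simp: bounded_functional_def algebra_simps\<close>)
qed

locale unital_cstar_subalgebra =
  fixes A :: "'a bop set"
  assumes cstar_subalgebra: "cstar_subalgebra A" and one_mem [simp]: "1 \<in> A"
begin

lemma zero_mem [simp]: "0 \<in> A"
  and add_mem [simp]: "x \<in> A \<Longrightarrow> y \<in> A \<Longrightarrow> x + y \<in> A"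
  and scaleC_mem [simp]: "x \<in> A \<Longrightarrow> c *\<^sub>C x \<in> A"
  and mult_mem [simp]: "x \<in> A \<Longrightarrow> y \<in> A \<Longrightarrow> x * y \<in> A"
  and adj_mem [simp]: "x \<in> A \<Longrightarrow> adj x \<in> A"
  and closed_carrier: "closed A"
  using cstar_subalgebra by (auto simp: cstar_subalgebra_def complex_subspace_def)

lemma scaleR_mem [simp]: "x \<in> A \<Longrightarrow> r *\<^sub>R x \<in> A"
  by (simp add: scaleR_scaleC)

lemma uminus_mem [simp]: "x \<in> A \<Longrightarrow> - x \<in> A"
  using scaleC_mem[of x "- 1"] by (simp only: scaleC_neg_one)

lemma diff_mem [simp]: "x \<in> A \<Longrightarrow> y \<in> A \<Longrightarrow> x - y \<in> A"
  using add_mem[of x "- y"] by simp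

lemma power_mem [simp]: "x \<in> A \<Longrightarrow> x ^ n \<in> A"
  by (induction n) auto

lemma sum_mem: "(\<And>i. i \<in> I \<Longrightarrow> f i \<in> A) \<Longrightarrow> sum f I \<in> A"
  by (induction I rule: infinite_finite_induct) auto

lemma bounded_functional_diff_arg:
  assumes "bounded_functional A f" "x \<in> A" "y \<in> A"
  shows "f (x - y) = f x - f y"
  using bounded_functional_add[OF assms(1,2), of "- 1 *\<^sub>C y"]
    bounded_functional_scaleC[OF assms(1,3), of "- 1"] assms
  by (simp only: scaleC_mem) (simp add: scaleC_neg_one)

lemma bounded_functional_zero: "bounded_functional A f \<Longrightarrow> f 0 = 0"
  using bounded_functional_scaleC[of A f 0 0] by (simp add: scaleC_zero)

lemma continuous_on_bounded_functional:
  assumes "bounded_functional A f"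
  shows "continuous_on A f"
proof -
  obtain K where K: "0 \<le> K" "\<And>x. x \<in> A \<Longrightarrow> cmod (f x) \<le> K * norm x"
    by (rule bounded_functional_bound[OF assms]) blast
  have "K-lipschitz_on A f"
    by (rule lipschitz_onI) (use K in \<open>auto simp: dist_norm simp flip: bounded_functional_diff_arg[OF assms]\<close>)
  then show ?thesis by (rule lipschitz_on_continuous_on)
qed

lemma bounded_functional_mult_both:
  assumes f: "bounded_functional A f" and ab: "a \<in> A" "b \<in> A"
  shows "bounded_functional A (\<lambda>x. f (a * x * b))"
proof -
  obtain K where K: "0 \<le> K" "\<And>x. x \<in> A \<Longrightarrow> cmod (f x) \<le> K * norm x"
    by (rule bounded_functional_bound[OF f]) blast
  show ?thesis
  proof (rule bounded_functionalI[where K="K * (norm a * norm b)"])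
    fix x assume x: "x \<in> A"
    have "cmod (f (a * x * b)) \<le> K * norm (a * x * b)" using x ab by (intro K) auto
    also have "\<dots> \<le> K * (norm (a * x) * norm b)" by (intro mult_left_mono norm_mult_ineq K)
    also have "\<dots> \<le> K * ((norm a * norm x) * norm b)"
      by (intro mult_left_mono mult_right_mono norm_mult_ineq K) auto
    finally show "cmod (f (a * x * b)) \<le> K * (norm a * norm b) * norm x" by (simp add: mult_ac)
  qed (use ab in \<open>auto simp: distrib_left distrib_right scaleC_mult_left scaleC_mult_right
        bounded_functional_add[OF f] bounded_functional_scaleC[OF f]\<close>)
qed

lemma bounded_functional_mult_left: "bounded_functional A f \<Longrightarrow> a \<in> A \<Longrightarrow> bounded_functional A (\<lambda>x. f (a * x))"
  using bounded_functional_mult_both[of f a 1] by simp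

lemma bounded_functional_mult_right: "bounded_functional A f \<Longrightarrow> b \<in> A \<Longrightarrow> bounded_functional A (\<lambda>x. f (x * b))"
  using bounded_functional_mult_both[of f 1 b] by simp

text \<open>The square root is the binomial series of \<open>(1 - h)\<^bsup>1/2\<^esup>\<close>.\<close>

lemma sqrt_one_minus:
  assumes h: "h \<in> A" "adj h = h" "norm h < 1"
  obtains y where "y \<in> A" "adj y = y" "y * y = 1 - h"
proof -
  define a :: "nat \<Rightarrow> real" where "a n = (- 1) ^ n * ((1/2) gchoose n)" for n
  define y where "y = (\<Sum>n. a n *\<^sub>R h ^ n)"
  \<comment> \<open>Convergence of the real binomial series at \<rho> gives absolute convergence at
    the smaller radius \<open>norm h\<close>.\<close>
  obtain \<rho> where \<rho>: "norm h < \<rho>" "\<rho> < 1" using dense h(3) by blast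
  have "0 < \<rho>" using \<rho> norm_ge_zero[of h] by linarith
  have "summable (\<lambda>n. ((1/2) gchoose n) * \<rho> ^ n)"
    using gen_binomial_real[of \<rho> "1/2"] \<rho> \<open>0 < \<rho>\<close> by (auto simp: sums_iff)
  then have "summable (\<lambda>n. norm (((1/2::real) gchoose n) * norm h ^ n))"
    by (rule powser_insidea) (use \<rho> in auto)
  then have norm_summable: "summable (\<lambda>n. norm (a n *\<^sub>R h ^ n))"
    by (rule summable_comparison_test[rotated])
      (auto intro!: exI[of _ 0] mult_left_mono norm_power_ineq simp: a_def abs_mult power_abs)
  then have sums: "(\<lambda>n. a n *\<^sub>R h ^ n) sums y"
    unfolding y_def by (rule summable_sums[OF summable_norm_cancel])
  show thesis
  proof (rule that)
    show "y \<in> A"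
      by (rule closed_sequentially[OF closed_carrier _ sums[unfolded sums_def]]) (auto intro!: sum_mem scaleR_mem power_mem h(1))
    have "(\<lambda>n. a n *\<^sub>R h ^ n) sums adj y"
      using bounded_linear.sums[OF bounded_linear_adj sums] by (simp add: adj_scaleR adj_power h(2))
    then show "adj y = y" by (rule sums_unique2[OF _ sums])
    have coeff: "(\<Sum>i\<le>k. (a i *\<^sub>R h ^ i) * (a (k - i) *\<^sub>R h ^ (k - i)))
        = ((- 1) ^ k * (1 gchoose k)) *\<^sub>R h ^ k" for k
    proof -
      have "(\<Sum>i\<le>k. (a i *\<^sub>R h ^ i) * (a (k - i) *\<^sub>R h ^ (k - i)))
          = (\<Sum>i\<le>k. (a i * a (k - i)) *\<^sub>R h ^ k)"
        by (intro sum.cong) (auto simp flip: power_add)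
      also have "\<dots> = (\<Sum>i\<le>k. a i * a (k - i)) *\<^sub>R h ^ k"
        by (simp add: scaleR_sum_left)
      also have "(\<Sum>i\<le>k. a i * a (k - i)) = (\<Sum>i\<le>k. (- 1) ^ k * (((1/2) gchoose i) * ((1/2) gchoose (k - i))))"
        by (intro sum.cong) (auto simp: a_def simp flip: power_add)
      \<comment> \<open>Vandermonde convolution: squaring the series for exponent 1/2 gives the
        coefficients for exponent 1, which vanish beyond degree 1.\<close>
      also have "\<dots> = (- 1) ^ k * ((1/2 + 1/2) gchoose k)"
        by (simp only: sum_distrib_left[symmetric] gbinomial_Vandermonde atMost_atLeast0)
      finally show ?thesis by simp
    qed
    have "(\<lambda>k. ((- 1) ^ k * (1 gchoose k)) *\<^sub>R h ^ k) sums (y * y)"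
      using Cauchy_product_sums[OF norm_summable norm_summable] by (simp only: coeff y_def)
    moreover have "(\<lambda>k. ((- 1) ^ k * (1 gchoose k)) *\<^sub>R h ^ k)
        sums (\<Sum>k\<in>{0,1}. ((- 1) ^ k * (1 gchoose k)) *\<^sub>R h ^ k)"
    proof (rule sums_finite)
      fix k :: nat assume "k \<notin> {0, 1}"
      then have "(1::real) gchoose k = 0"
        using binomial_gbinomial[of 1 k, where 'a=real] by (simp add: binomial_eq_0)
      then show "((- 1) ^ k * (1 gchoose k)) *\<^sub>R h ^ k = 0" by simp
    qed simp
    ultimately have "y * y = (\<Sum>k\<in>{0,1}. ((- 1) ^ k * (1 gchoose k)) *\<^sub>R h ^ k)"
      by (rule sums_unique2)
    then show "y * y = 1 - h" by simp
  qed
qed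

section \<open>Positivity, the Cauchy-Schwarz inequality and boundedness of states\<close>

context
  fixes \<phi> :: "'a bop \<Rightarrow> complex"
  assumes state: "state A \<phi>"
begin

lemma state_add: "x \<in> A \<Longrightarrow> y \<in> A \<Longrightarrow> \<phi> (x + y) = \<phi> x + \<phi> y"
  and state_scaleC: "x \<in> A \<Longrightarrow> \<phi> (c *\<^sub>C x) = c * \<phi> x"
  and state_positive: "x \<in> A \<Longrightarrow> \<phi> (adj x * x) \<in> \<real>\<^sub>\<ge>\<^sub>0"
  and state_one: "\<phi> 1 = 1"
  using state by (auto simp: state_def)

lemma state_expand:
  assumes "x \<in> A" "y \<in> A"
  shows "\<phi> (adj (x + c *\<^sub>C y) * (x + c *\<^sub>C y))
    = \<phi> (adj x * x) + c * \<phi> (adj x * y) + cnj c * \<phi> (adj y * x) + c * cnj c * \<phi> (adj y * y)"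
  using assms
  by (simp add: adj_add adj_scaleC distrib_left distrib_right scaleC_mult_left scaleC_mult_right
      scaleC_scaleC state_add state_scaleC)

lemma state_hermitian:
  assumes "x \<in> A" "y \<in> A"
  shows "\<phi> (adj x * y) = cnj (\<phi> (adj y * x))"
proof -
  have real: "Im (c * \<phi> (adj x * y) + cnj c * \<phi> (adj y * x)) = 0" for c
  proof -
    have "\<phi> (adj (x + c *\<^sub>C y) * (x + c *\<^sub>C y)) \<in> \<real>\<^sub>\<ge>\<^sub>0" "\<phi> (adj x * x) \<in> \<real>\<^sub>\<ge>\<^sub>0" "\<phi> (adj y * y) \<in> \<real>\<^sub>\<ge>\<^sub>0"
      using assms by (intro state_positive; simp)+
    then show ?thesis
      unfolding state_expand[OF assms]
      by (auto simp: complex_nonneg_Reals_iff)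
  qed
  \<comment> \<open>The value c = 1 compares imaginary parts, c = \<i> compares real parts.\<close>
  show ?thesis using real[of 1] real[of \<i>] by (simp add: complex_eq_iff)
qed

lemma state_adj: "x \<in> A \<Longrightarrow> \<phi> (adj x) = cnj (\<phi> x)"
  using state_hermitian[of x 1] by simp

text \<open>Positivity at x - t u y, with u the value to be bounded and t real, is a quadratic
  inequality in t; the factor u aligns the phases so that the cross terms are real.\<close>

lemma state_Cauchy_Schwarz:
  assumes "x \<in> A" "y \<in> A"
  shows "(cmod (\<phi> (adj y * x)))\<^sup>2 \<le> Re (\<phi> (adj x * x)) * Re (\<phi> (adj y * y))"
proof -
  define u where "u = \<phi> (adj y * x)"
  define a where "a = Re (\<phi> (adj x * x))"
  define b where "b = Re (\<phi> (adj y * y))"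
  have nonneg: "0 \<le> a" "0 \<le> b"
    using state_positive assms by (auto simp: a_def b_def complex_nonneg_Reals_iff)
  have quad: "0 \<le> a - 2 * t * (cmod u)\<^sup>2 + t\<^sup>2 * (cmod u)\<^sup>2 * b" for t :: real
  proof -
    define c where "c = - (complex_of_real t * u)"
    have "0 \<le> Re (\<phi> (adj (x + c *\<^sub>C y) * (x + c *\<^sub>C y)))"
      using state_positive[of "x + c *\<^sub>C y"] assms by (auto simp: complex_nonneg_Reals_iff)
    also have "\<phi> (adj (x + c *\<^sub>C y) * (x + c *\<^sub>C y))
        = complex_of_real a + c * cnj u + cnj c * u + c * cnj c * complex_of_real b"
      unfolding state_expand[OF assms] u_def a_def b_def state_hermitian[OF assms]
      using state_positive[OF assms(1)] state_positive[OF assms(2)]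
      by (simp add: complex_nonneg_Reals_iff complex_eq_iff)
    also have "Re \<dots> = a - 2 * t * (cmod u)\<^sup>2 + t\<^sup>2 * (cmod u)\<^sup>2 * b"
      unfolding c_def cmod_power2 by (simp add: algebra_simps power2_eq_square)
    finally show ?thesis .
  qed
  have "(cmod u)\<^sup>2 \<le> a * b"
  proof (cases "b = 0")
    case True
    have "u = 0"
    proof (rule ccontr)
      assume "u \<noteq> 0"
      then show False
        \<comment> \<open>With b = 0 the quadratic is linear in t, and this t gives it the value
          -1.\<close>
        using quad[of "(a + 1) / (2 * (cmod u)\<^sup>2)"] True by simp
    qed
    then show ?thesis using nonneg by simp
  next
    case False
    then have "0 \<le> a - (cmod u)\<^sup>2 / b"
      using quad[of "1 / b"] by (simp add: power2_eq_square)
    then show ?thesis using False nonneg by (simp add: field_simps)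
  qed
  then show ?thesis by (simp add: u_def a_def b_def)
qed

text \<open>After division by K^2, the element 1 - h has a self-adjoint square root in the algebra,
  so its value is nonnegative. The strict inequality on K ensures \<open>norm h < 1\<close>, as the
  series requires.\<close>

lemma state_adj_mult_self_le:
  assumes x: "x \<in> A" and K: "norm x < K"
  shows "Re (\<phi> (adj x * x)) \<le> K\<^sup>2"
proof -
  have "0 < K" using K norm_ge_zero[of x] by linarith
  define h where "h = (1 / K\<^sup>2) *\<^sub>R (adj x * x)"
  have "norm h \<le> (norm x)\<^sup>2 / K\<^sup>2"
    using norm_adj_mult_self_le[of x] by (simp add: h_def divide_right_mono)
  also have "\<dots> < 1" using K \<open>0 < K\<close> by (simp add: power_strict_mono)
  finally obtain y where y: "y \<in> A" "adj y = y" "y * y = 1 - h"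
    using sqrt_one_minus[of h] x by (auto simp: h_def adj_scaleR adj_mult)
  have "\<phi> (adj y * y) + \<phi> h = 1"
    using state_add[of "1 - h" h] y x by (simp add: state_one h_def)
  then have "Re (\<phi> h) \<le> 1"
    using state_positive[OF y(1)] by (auto simp: complex_nonneg_Reals_iff complex_eq_iff)
  moreover have "\<phi> h = complex_of_real (1 / K\<^sup>2) * \<phi> (adj x * x)"
    unfolding h_def scaleR_scaleC using x by (intro state_scaleC) simp
  ultimately show ?thesis using \<open>0 < K\<close> by (simp add: field_simps del: of_real_divide)
qed

text \<open>Cauchy-Schwarz against the unit reduces to \<open>adj x * x\<close>; then K decreases to
  \<open>norm x\<close>.\<close>

lemma state_bound:
  assumes x: "x \<in> A"
  shows "cmod (\<phi> x) \<le> norm x"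
proof (rule dense_ge)
  fix K assume K: "norm x < K"
  then have "0 < K" using norm_ge_zero[of x] by linarith
  have "(cmod (\<phi> x))\<^sup>2 \<le> Re (\<phi> (adj x * x))"
    using state_Cauchy_Schwarz[OF x one_mem] by (simp add: state_one)
  also have "\<dots> \<le> K\<^sup>2" by (rule state_adj_mult_self_le[OF x K])
  finally show "cmod (\<phi> x) \<le> K" using \<open>0 < K\<close> by (simp add: abs_le_square_iff[symmetric])
qed

lemma state_bounded_functional: "bounded_functional A \<phi>"
  by (rule bounded_functionalI[where K=1]) (auto simp: state_add state_scaleC state_bound)

end

end


section \<open>The affine semigroup and the spanning set of its Toeplitz algebra\<close>

definition shift_part :: "affine_nat \<Rightarrow> nat" where
  "shift_part x = fst (affine_pair x)"

definition scale_part :: "affine_nat \<Rightarrow> nat" where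
  "scale_part x = snd (affine_pair x)"

lemma affine_nat_eqI: "shift_part x = shift_part y \<Longrightarrow> scale_part x = scale_part y \<Longrightarrow> x = y"
  by (simp add: shift_part_def scale_part_def prod_eq_iff flip: affine_pair_inject)

lemma scale_part_pos [simp]: "0 < scale_part x"
  using affine_pair[of x] by (simp add: scale_part_def)

lemma shift_part_mult [simp]: "shift_part (x * y) = shift_part x + scale_part x * shift_part y"
  and scale_part_mult [simp]: "scale_part (x * y) = scale_part x * scale_part y"
  and shift_part_one [simp]: "shift_part 1 = 0"
  and scale_part_one [simp]: "scale_part 1 = 1"
  by (simp_all add: shift_part_def scale_part_def times_affine_nat.rep_eq one_affine_nat.rep_eq
      case_prod_beta)

lemma shift_part_affine [simp]: "0 < a \<Longrightarrow> shift_part (affine (m, a)) = m"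
  and scale_part_affine [simp]: "0 < a \<Longrightarrow> scale_part (affine (m, a)) = a"
  by (simp_all add: shift_part_def scale_part_def affine_inverse)

lemma affine_nat_eq_iff: "x = y \<longleftrightarrow> shift_part x = shift_part y \<and> scale_part x = scale_part y"
  using affine_nat_eqI by blast

text \<open>Writing p = (k, c) and q = (j, d), the equation splits into m + a k = l + b j and a c =
  b d. With a = g a', b = g b' and a', b' coprime, solutions of the second are the multiples of (b',
  a'), and those of the first are a least solution plus multiples of (b', a').\<close>

lemma affine_nat_common_multiples:
  assumes "x * p\<^sub>0 = z * q\<^sub>0"
  obtains u w :: affine_nat where "\<forall>p q. x * p = z * q \<longleftrightarrow> (\<exists>r. p = w * r \<and> q = u * r)"
proof -
  define m a l b where defs: "m = shift_part x" "a = scale_part x" "l = shift_part z" "b = scale_part z"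
  have pos: "0 < a" "0 < b" by (simp_all add: defs)
  define g where "g = gcd a b"
  have "0 < g" using pos by (simp add: g_def)
  then obtain a' b' where a': "a = g * a'" and b': "b = g * b'" and cop: "coprime a' b'"
    using gcd_coprime_exists[of a b] unfolding g_def by (metis mult.commute less_irrefl)
  have pos': "0 < g" "0 < a'" "0 < b'" using pos a' b' by auto
  define k\<^sub>0 where "k\<^sub>0 = (LEAST k. \<exists>j. m + a * k = l + b * j)"
  have "m + a * shift_part p\<^sub>0 = l + b * shift_part q\<^sub>0"
    using assms by (auto simp: affine_nat_eq_iff defs)
  then have "\<exists>j. m + a * k\<^sub>0 = l + b * j"
    unfolding k\<^sub>0_def by (intro LeastI[of "\<lambda>k. \<exists>j. m + a * k = l + b * j"]) blast
  then obtain j\<^sub>0 where j\<^sub>0: "m + a * k\<^sub>0 = l + b * j\<^sub>0" by blast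
  have least: "k\<^sub>0 \<le> k" if "m + a * k = l + b * j" for k j
    unfolding k\<^sub>0_def using that by (intro Least_le) blast
  show thesis
  proof (rule that[of "affine (k\<^sub>0, b')" "affine (j\<^sub>0, a')"], intro allI)
    fix p q
    let ?w = "affine (k\<^sub>0, b')" and ?u = "affine (j\<^sub>0, a')"
    have "x * ?w = z * ?u"
      using j\<^sub>0 pos' by (simp add: affine_nat_eq_iff flip: defs) (simp add: a' b')
    moreover have "\<exists>r. p = ?w * r \<and> q = ?u * r" if eq: "x * p = z * q"
    proof -
      define k j c d where pq: "k = shift_part p" "j = shift_part q" "c = scale_part p" "d = scale_part q"
      have kj: "m + a * k = l + b * j" and cd: "a * c = b * d"
        using eq by (auto simp: affine_nat_eq_iff defs pq)
      have "k\<^sub>0 \<le> k" by (rule least[OF kj])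
      \<comment> \<open>Minimality of \<open>k\<^sub>0\<close> passes to \<open>j\<^sub>0\<close>,
        so both differences are natural numbers.\<close>
      then have "b * j\<^sub>0 \<le> b * j" using kj j\<^sub>0 mult_le_mono2[of k\<^sub>0 k a] by linarith
      then have "j\<^sub>0 \<le> j" using pos by simp
      then obtain j' where j': "j = j\<^sub>0 + j'" by (auto simp: le_iff_add)
      obtain k' where k': "k = k\<^sub>0 + k'" using \<open>k\<^sub>0 \<le> k\<close> by (auto simp: le_iff_add)
      have "a * k' = b * j'" using kj j\<^sub>0 k' j' by (simp add: algebra_simps)
      then have eq1: "a' * k' = b' * j'" using pos' by (simp add: a' b')
      then have "b' dvd k'" using cop by (metis coprime_commute coprime_dvd_mult_right_iff dvd_triv_left)
      then obtain t where t: "k' = b' * t" by blast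
      then have "j' = a' * t" using eq1 pos' by simp
      have eq2: "a' * c = b' * d" using cd pos' by (simp add: a' b')
      then have "b' dvd c" using cop by (metis coprime_commute coprime_dvd_mult_right_iff dvd_triv_left)
      then obtain e where e: "c = b' * e" by blast
      then have "d = a' * e" using eq2 pos' by simp
      have "0 < e" using e scale_part_pos[of p] by (cases e) (auto simp flip: pq)
      then have "p = ?w * affine (t, e) \<and> q = ?u * affine (t, e)"
        using pos' k' j' t e \<open>j' = a' * t\<close> \<open>d = a' * e\<close>
        by (simp add: affine_nat_eq_iff flip: pq)
      then show ?thesis by blast
    qed
    ultimately show "x * p = z * q \<longleftrightarrow> (\<exists>r. p = ?w * r \<and> q = ?u * r)"
      by (metis mult.assoc)
  qed
qed

section \<open>Products of the isometries and their adjoints\<close>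

lemma affine_nat_left_cancel [simp]: "x * p = x * q \<longleftrightarrow> p = (q :: affine_nat)"
  by (auto dest: injD[OF inj_affine_mult])

lemma toeplitz_isometry_mult: "toeplitz_isometry (x * y) = toeplitz_isometry x * toeplitz_isometry y"
  by (rule bop_eq_matrixI) (simp add: times_bop_apply toeplitz_isometry_ket mult.assoc)

lemma toeplitz_isometry_one: "toeplitz_isometry 1 = 1"
  by (rule bop_eq_matrixI) (simp add: one_bop_apply toeplitz_isometry_ket)

lemma cinner_ket_ket: "cinner (ket x) (ket y) = (if x = y then 1 else 0)"
  by (auto simp: cinner_ket_right ket.rep_eq)

lemma adj_toeplitz_isometry_ket: "adj (toeplitz_isometry w) \<cdot> ket (w * r) = ket r"
proof (rule ell2_eqI)
  fix i
  have "cinner (adj (toeplitz_isometry w) \<cdot> ket (w * r)) (ket i) = cinner (ket r) (ket i)"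
    by (simp add: cinner_adj' toeplitz_isometry_ket cinner_ket_ket)
  then show "ell2_coord (adj (toeplitz_isometry w) \<cdot> ket (w * r)) i = ell2_coord (ket r) i"
    by (simp add: cinner_ket_right)
qed

lemma adj_toeplitz_isometry_ket_zero:
  assumes "\<And>r. p \<noteq> w * r"
  shows "adj (toeplitz_isometry w) \<cdot> ket p = 0"
proof (rule ell2_eqI)
  fix i
  have "cinner (adj (toeplitz_isometry w) \<cdot> ket p) (ket i) = 0"
    using assms[of i] by (auto simp: cinner_adj' toeplitz_isometry_ket cinner_ket_ket)
  then show "ell2_coord (adj (toeplitz_isometry w) \<cdot> ket p) i = ell2_coord 0 i"
    by (simp add: cinner_ket_right zero_ell2.rep_eq)
qed

lemma bop_apply_zero: "x \<cdot> 0 = 0"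
  by (rule linear_0[OF bounded_linear.linear[OF bounded_linear_bop_apply]])

lemma zero_bop_apply: "(0 :: 'a bop) \<cdot> \<xi> = 0"
  by (simp add: bop_apply.rep_eq zero_bop.rep_eq)

lemma cinner_zero_left: "cinner 0 f = 0"
  by (rule linear_0[OF bounded_linear.linear[OF bounded_linear_cinner_left]])

text \<open>The word is the partial isometry that sends \<open>ket (w * r)\<close> to
  \<open>ket (u * r)\<close> and kills the kets outside the right ideal of w.\<close>

lemma cinner_toeplitz_word:
  "cinner ((toeplitz_isometry u * adj (toeplitz_isometry w)) \<cdot> ket p) (ket q)
    = (if \<exists>r. p = w * r \<and> q = u * r then 1 else 0)"
proof (cases "\<exists>r. p = w * r")
  case True
  then obtain r where r: "p = w * r" by blast
  then have "(\<exists>r. p = w * r \<and> q = u * r) \<longleftrightarrow> u * r = q"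
    by auto
  then show ?thesis
    by (simp add: times_bop_apply r adj_toeplitz_isometry_ket toeplitz_isometry_ket cinner_ket_ket)
next
  case False
  then show ?thesis
    by (auto simp: times_bop_apply adj_toeplitz_isometry_ket_zero bop_apply_zero cinner_zero_left)
qed

lemma cinner_toeplitz_coword:
  "cinner ((adj (toeplitz_isometry z) * toeplitz_isometry x) \<cdot> ket p) (ket q)
    = (if x * p = z * q then 1 else 0)"
  by (simp add: times_bop_apply cinner_adj' toeplitz_isometry_ket cinner_ket_ket)

text \<open>Both sides have matrices with entries 0 and 1, and the hypothesis says that their
  supports agree.\<close>

lemma adj_toeplitz_isometry_mult:
  assumes "\<And>p q. x * p = z * q \<longleftrightarrow> (\<exists>r. p = w * r \<and> q = u * r)"
  shows "adj (toeplitz_isometry z) * toeplitz_isometry x = toeplitz_isometry u * adj (toeplitz_isometry w)"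
  by (rule bop_eq_matrixI) (simp only: cinner_toeplitz_coword cinner_toeplitz_word assms)

lemma adj_toeplitz_isometry_self: "adj (toeplitz_isometry x) * toeplitz_isometry x = 1"
proof -
  have "adj (toeplitz_isometry x) * toeplitz_isometry x = toeplitz_isometry 1 * adj (toeplitz_isometry 1)"
    by (rule adj_toeplitz_isometry_mult) auto
  then show ?thesis by (simp add: toeplitz_isometry_one)
qed

text \<open>Nica covariance: the product is governed by the least common right multiple x w = z u,
  and is zero when x and z have no common right multiple.\<close>

lemma adj_toeplitz_isometry_mult_cases:
  obtains "adj (toeplitz_isometry z) * toeplitz_isometry x = 0"
  | u w where "x * w = z * u"
      "adj (toeplitz_isometry z) * toeplitz_isometry x = toeplitz_isometry u * adj (toeplitz_isometry w)"
proof (cases "\<exists>p q. x * p = z * q")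
  case True
  then obtain p\<^sub>0 q\<^sub>0 where "x * p\<^sub>0 = z * q\<^sub>0" by blast
  then obtain u w where uw: "\<forall>p q. x * p = z * q \<longleftrightarrow> (\<exists>r. p = w * r \<and> q = u * r)"
    by (rule affine_nat_common_multiples)
  then have "x * w = z * u" by (metis mult.right_neutral)
  then show thesis by (rule that(2)) (rule adj_toeplitz_isometry_mult, simp only: uw)
next
  case False
  then have "adj (toeplitz_isometry z) * toeplitz_isometry x = 0"
    by (intro bop_eq_matrixI) (simp add: cinner_toeplitz_coword zero_bop_apply cinner_zero_left)
  then show thesis by (rule that(1))
qed

lemma cstar_subalgebra_Inter: "Ball \<A> cstar_subalgebra \<Longrightarrow> cstar_subalgebra (\<Inter>\<A>)"
  unfolding cstar_subalgebra_def complex_subspace_def by (auto intro!: closed_Inter)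

lemma toeplitz_isometry_mem [simp]: "toeplitz_isometry x \<in> toeplitz_algebra"
  unfolding toeplitz_algebra_def cstar_generated_def by (rule hull_inc) simp

lemma unital_cstar_subalgebra_toeplitz: "unital_cstar_subalgebra toeplitz_algebra"
proof
  show "cstar_subalgebra toeplitz_algebra"
    unfolding toeplitz_algebra_def cstar_generated_def by (rule hull_in) (rule cstar_subalgebra_Inter)
  show "1 \<in> toeplitz_algebra"
    using toeplitz_isometry_mem[of 1] by (simp only: toeplitz_isometry_one)
qed

interpretation toeplitz: unital_cstar_subalgebra toeplitz_algebra
  by (rule unital_cstar_subalgebra_toeplitz)

text \<open>The conjugate-linear alternative in \<open>scale\<close> is there for the map
  \<open>adj\<close>.\<close>

lemma closed_complex_subspace_vimage:
  fixes f :: "'a bop \<Rightarrow> 'a bop"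
  assumes V: "complex_subspace V" "closed V" and f: "bounded_linear f"
    and scale: "\<And>c x. f (c *\<^sub>C x) = c *\<^sub>C f x \<or> f (c *\<^sub>C x) = cnj c *\<^sub>C f x"
  shows "complex_subspace (f -` V) \<and> closed (f -` V)"
proof
  interpret f: bounded_linear f by fact
  have "f (c *\<^sub>C x) \<in> V" if "f x \<in> V" for c x
    using V(1) that scale[of c x] by (auto simp: complex_subspace_def)
  then show "complex_subspace (f -` V)"
    using V(1) by (auto simp: complex_subspace_def f.zero f.add)
  show "closed (f -` V)"
    by (rule closed_vimage[OF V(2) linear_continuous_on[OF f]])
qed

text \<open>The least closed subspace containing the words is already a C*-algebra, because
  covariance makes a product of two words zero or again a word.\<close>

theorem toeplitz_algebra_subset:
  assumes V: "complex_subspace V" "closed V"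
    and words: "\<And>x y. toeplitz_isometry x * adj (toeplitz_isometry y) \<in> V"
  shows "toeplitz_algebra \<subseteq> V"
proof -
  let ?T = toeplitz_isometry
  define \<V> where "\<V> = {V :: affine_nat bop set. complex_subspace V \<and> closed V \<and> (\<forall>x y. ?T x * adj (?T y) \<in> V)}"
  define W where "W = \<Inter>\<V>"
  have sub: "complex_subspace W" "closed W"
    unfolding W_def \<V>_def complex_subspace_def by (auto intro!: closed_Inter)
  have word: "?T x * adj (?T y) \<in> W" for x y by (auto simp: W_def \<V>_def)
  have zero: "0 \<in> W" using sub(1) by (simp add: complex_subspace_def)
  \<comment> \<open>Induction principle for W: the preimage of W under such a map is a closed
    subspace, so containing the words it contains W.\<close>
  have least: "W \<subseteq> f -` W"
    if "bounded_linear f" "\<And>c x. f (c *\<^sub>C x) = c *\<^sub>C f x \<or> f (c *\<^sub>C x) = cnj c *\<^sub>C f x"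
      "\<And>x y. f (?T x * adj (?T y)) \<in> W" for f
    using closed_complex_subspace_vimage[OF sub that(1,2)] that(3) by (auto simp: W_def \<V>_def)
  have word_mult: "(?T x * adj (?T y)) * (?T x' * adj (?T y')) \<in> W" for x y x' y'
  proof (cases rule: adj_toeplitz_isometry_mult_cases[of y x'])
    case 1
    have "(?T x * adj (?T y)) * (?T x' * adj (?T y')) = ?T x * (adj (?T y) * ?T x') * adj (?T y')"
      by (simp add: mult.assoc)
    then show ?thesis using zero by (simp add: 1)
  next
    case (2 u w)
    have "(?T x * adj (?T y)) * (?T x' * adj (?T y')) = ?T x * (adj (?T y) * ?T x') * adj (?T y')"
      by (simp add: mult.assoc)
    also have "\<dots> = ?T (x * u) * adj (?T (y' * w))"
      by (simp add: 2 toeplitz_isometry_mult adj_mult mult.assoc)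
    finally show ?thesis using word by simp
  qed
  \<comment> \<open>Closure under products takes two inductions: the right factor is generalised
    with a word on the left, then the left factor.\<close>
  have left: "(?T x * adj (?T y)) * b \<in> W" if "b \<in> W" for x y b
    using least[of "\<lambda>b. (?T x * adj (?T y)) * b"] that word_mult
    by (auto simp: bounded_linear_mult_right scaleC_mult_right)
  have "a * b \<in> W" if "a \<in> W" "b \<in> W" for a b
    using least[of "\<lambda>a. a * b"] that left
    by (auto simp: bounded_linear_mult_left scaleC_mult_left)
  moreover have "adj a \<in> W" if "a \<in> W" for a
    using least[of adj] that word by (auto simp: bounded_linear_adj adj_scaleC adj_mult)
  ultimately have "cstar_subalgebra W"
    using sub by (auto simp: cstar_subalgebra_def)
  moreover have "range ?T \<subseteq> W"
  proof safe
    show "?T x \<in> W" for x using word[of x 1] by (simp add: toeplitz_isometry_one)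
  qed
  ultimately have "toeplitz_algebra \<subseteq> W"
    unfolding toeplitz_algebra_def cstar_generated_def by (intro hull_minimal)
  also have "W \<subseteq> V" using assms by (auto simp: W_def \<V>_def)
  finally show ?thesis .
qed

text \<open>The density argument used throughout: the zero set of the difference is a closed
  subspace containing the words.\<close>

lemma toeplitz_functional_eq:
  assumes "bounded_functional toeplitz_algebra f" "bounded_functional toeplitz_algebra g"
    and words: "\<And>x y. f (toeplitz_isometry x * adj (toeplitz_isometry y))
                      = g (toeplitz_isometry x * adj (toeplitz_isometry y))"
    and x: "x \<in> toeplitz_algebra"
  shows "f x = g x"
proof -
  let ?A = toeplitz_algebra
  define h where "h x = f x - g x" for x
  have h: "bounded_functional ?A h"
    unfolding h_def by (rule bounded_functional_diff[OF assms(1,2)])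
  have "?A \<subseteq> {x \<in> ?A. h x = 0}"
  proof (rule toeplitz_algebra_subset)
    show "complex_subspace {x \<in> ?A. h x = 0}"
      by (auto simp: complex_subspace_def toeplitz.bounded_functional_zero[OF h]
          bounded_functional_add[OF h] bounded_functional_scaleC[OF h])
    show "closed {x \<in> ?A. h x = 0}"
      by (rule continuous_closed_preimage_constant[OF toeplitz.continuous_on_bounded_functional[OF h]
            toeplitz.closed_carrier])
  qed (auto simp: h_def words)
  then show ?thesis using x by (auto simp: h_def)
qed


section \<open>Factoring through the additive boundary quotient\<close>

text \<open>The second hypothesis makes the family of ideals nonempty, so that the intersection
  stays inside A.\<close>

lemma closed_ideal_ideal_generated:
  assumes "X \<subseteq> A" "closed_ideal A A"
  shows "closed_ideal A (ideal_generated A X)"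
proof -
  have "ideal_generated A X = \<Inter>{J. closed_ideal A J \<and> X \<subseteq> J}"
    by (simp add: ideal_generated_def hull_def)
  moreover have "A \<in> {J. closed_ideal A J \<and> X \<subseteq> J}" using assms by simp
  moreover have "closed (\<Inter>{J. closed_ideal A J \<and> X \<subseteq> J})"
    by (rule closed_Inter) (auto simp: closed_ideal_def)
  ultimately show ?thesis
    unfolding closed_ideal_def complex_subspace_def by auto
qed

lemma quotient_map_eq_iff:
  assumes "complex_subspace J"
  shows "quotient_map J x = quotient_map J y \<longleftrightarrow> x - y \<in> J"
proof
  have J: "0 \<in> J" "\<And>a b. a \<in> J \<Longrightarrow> b \<in> J \<Longrightarrow> a + b \<in> J" "\<And>c a. a \<in> J \<Longrightarrow> c *\<^sub>C a \<in> J"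
    using assms by (auto simp: complex_subspace_def)
  have mem: "z \<in> quotient_map J w \<longleftrightarrow> z - w \<in> J" for z w
    by (auto simp: quotient_map_def intro!: exI[of _ "z - w"])
  show "x - y \<in> J" if "quotient_map J x = quotient_map J y"
    using that mem[of x x] mem[of x y] J(1) by simp
  show "quotient_map J x = quotient_map J y" if xy: "x - y \<in> J"
  proof -
    have "y - x \<in> J" using J(3)[OF xy, of "- 1"] by (simp add: scaleC_neg_one)
    then have "z - x \<in> J \<longleftrightarrow> z - y \<in> J" for z
      using J(2)[of "z - x" "x - y"] J(2)[of "z - y" "y - x"] xy by auto
    then show ?thesis by (auto simp: mem)
  qed
qed

lemma gen_s_mem [simp]: "gen_s \<in> toeplitz_algebra"
  by (simp add: gen_s_def)

text \<open>The elements x of the algebra with \<open>\<phi> (a * x * b) = 0\<close> for all a and b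
  form a closed ideal on which \<phi> vanishes. If it contains 1 - s s*, it contains the generated
  ideal.\<close>

lemma factors_through_q_add_iff:
  assumes \<phi>: "bounded_functional toeplitz_algebra \<phi>"
  shows "factors_through toeplitz_algebra q_add \<phi> \<longleftrightarrow>
    (\<forall>a\<in>toeplitz_algebra. \<forall>b\<in>toeplitz_algebra. \<phi> (a * (1 - gen_s * adj gen_s) * b) = 0)"
proof -
  let ?A = toeplitz_algebra
  define P where "P = 1 - gen_s * adj gen_s"
  define J where "J = ideal_generated ?A {P}"
  have P: "P \<in> ?A" by (simp add: P_def)
  have "closed_ideal ?A ?A"
    by (auto simp: closed_ideal_def complex_subspace_def toeplitz.closed_carrier)
  then have J: "closed_ideal ?A J"
    unfolding J_def using P by (intro closed_ideal_ideal_generated) auto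
  then have J_sub: "complex_subspace J" "J \<subseteq> ?A" by (auto simp: closed_ideal_def)
  have "P \<in> J" unfolding J_def ideal_generated_def by (rule hull_inc) simp
  have q: "q_add x = q_add y \<longleftrightarrow> x - y \<in> J" for x y
    unfolding q_add_def P_def[symmetric] J_def[symmetric] by (rule quotient_map_eq_iff[OF J_sub(1)])
  show ?thesis unfolding P_def[symmetric]
  proof (intro iffI ballI)
    fix a b assume *: "factors_through ?A q_add \<phi>" and ab: "a \<in> ?A" "b \<in> ?A"
    have "a * P * b \<in> J" using J \<open>P \<in> J\<close> ab by (auto simp: closed_ideal_def)
    then have "q_add (a * P * b) = q_add 0" by (simp add: q)
    moreover obtain \<psi> where "\<forall>x\<in>?A. \<phi> x = \<psi> (q_add x)" using * by (auto simp: factors_through_def)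
    ultimately have "\<phi> (a * P * b) = \<phi> 0" using ab P by simp
    then show "\<phi> (a * P * b) = 0" by (simp add: toeplitz.bounded_functional_zero[OF \<phi>])
  next
    assume *: "\<forall>a\<in>?A. \<forall>b\<in>?A. \<phi> (a * P * b) = 0"
    define N where "N a b = {x \<in> ?A. \<phi> (a * x * b) = 0}" for a b
    define I where "I = {x \<in> ?A. \<forall>a\<in>?A. \<forall>b\<in>?A. \<phi> (a * x * b) = 0}"
    have I: "I = (\<Inter>a\<in>?A. \<Inter>b\<in>?A. N a b)"
      using toeplitz.one_mem unfolding I_def N_def by blast
    have "closed (N a b)" if "a \<in> ?A" "b \<in> ?A" for a b
      unfolding N_def using that
      by (intro continuous_closed_preimage_constant toeplitz.continuous_on_bounded_functional
          toeplitz.bounded_functional_mult_both \<phi> toeplitz.closed_carrier)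
    then have "closed I" unfolding I by (intro closed_INT ballI) auto
    moreover have "complex_subspace I"
      by (auto simp: I_def complex_subspace_def toeplitz.bounded_functional_zero[OF \<phi>] distrib_left
          distrib_right scaleC_mult_left scaleC_mult_right bounded_functional_add[OF \<phi>]
          bounded_functional_scaleC[OF \<phi>])
    moreover have "x * j \<in> I \<and> j * x \<in> I" if "x \<in> ?A" "j \<in> I" for x j
    proof -
      have "\<phi> ((a * x) * j * b) = 0" "\<phi> (a * j * (x * b)) = 0" if "a \<in> ?A" "b \<in> ?A" for a b
        using that \<open>j \<in> I\<close> \<open>x \<in> ?A\<close> by (simp_all add: I_def)
      then show ?thesis using that by (auto simp: I_def mult.assoc)
    qed
    ultimately have "closed_ideal ?A I"
      by (auto simp: closed_ideal_def I_def)
    then have "J \<subseteq> I"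
      unfolding J_def ideal_generated_def using * P by (intro hull_minimal) (auto simp: I_def)
    have zero: "\<phi> j = 0" if "j \<in> J" for j
    proof -
      have "\<phi> (1 * j * 1) = 0"
        using that \<open>J \<subseteq> I\<close> toeplitz.one_mem unfolding I_def by blast
      then show ?thesis by simp
    qed
    have wd: "\<phi> x = \<phi> y" if "x \<in> ?A" "y \<in> ?A" "q_add x = q_add y" for x y
      using zero[of "x - y"] toeplitz.bounded_functional_diff_arg[OF \<phi>] that by (simp add: q)
    show "factors_through ?A q_add \<phi>"
      unfolding factors_through_def
    \<comment> \<open>The functional on the quotient evaluates \<phi> at a chosen representative;
      \<open>wd\<close> makes the choice irrelevant.\<close>
    proof (intro exI[of _ "\<lambda>Q. \<phi> (SOME x. x \<in> ?A \<and> q_add x = Q)"] ballI)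
      fix x assume x: "x \<in> ?A"
      then have "(SOME y. y \<in> ?A \<and> q_add y = q_add x) \<in> ?A \<and>
          q_add (SOME y. y \<in> ?A \<and> q_add y = q_add x) = q_add x"
        by (intro someI[of "\<lambda>y. y \<in> ?A \<and> q_add y = q_add x" x]) simp
      then show "\<phi> x = \<phi> (SOME y. y \<in> ?A \<and> q_add y = q_add x)"
        using wd[OF x] by metis
    qed
  qed
qed


section \<open>Homogeneous elements\<close>

locale toeplitz_flow =
  fixes \<sigma> :: "real \<Rightarrow> affine_nat bop \<Rightarrow> affine_nat bop"
  assumes dynamics: "toeplitz_dynamics \<sigma>"
begin

lemma flow_automorphism: "star_automorphism toeplitz_algebra (\<sigma> t)"
  using dynamics by (simp add: toeplitz_dynamics_def dynamical_system_def)

lemma flow_mem [simp]: "x \<in> toeplitz_algebra \<Longrightarrow> \<sigma> t x \<in> toeplitz_algebra"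
  and flow_add: "x \<in> toeplitz_algebra \<Longrightarrow> y \<in> toeplitz_algebra \<Longrightarrow> \<sigma> t (x + y) = \<sigma> t x + \<sigma> t y"
  and flow_scaleC: "x \<in> toeplitz_algebra \<Longrightarrow> \<sigma> t (c *\<^sub>C x) = c *\<^sub>C \<sigma> t x"
  and flow_mult: "x \<in> toeplitz_algebra \<Longrightarrow> y \<in> toeplitz_algebra \<Longrightarrow> \<sigma> t (x * y) = \<sigma> t x * \<sigma> t y"
  and flow_adj: "x \<in> toeplitz_algebra \<Longrightarrow> \<sigma> t (adj x) = adj (\<sigma> t x)"
  using flow_automorphism[of t] by (auto simp: star_automorphism_def dest: bij_betw_apply)

text \<open>An eigenspace of the flow. Degrees are logarithms, p^(it) = exp (i t ln p), so that they
  add under multiplication.\<close>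

definition homogeneous :: "real \<Rightarrow> affine_nat bop \<Rightarrow> bool" where
  "homogeneous l d \<longleftrightarrow> d \<in> toeplitz_algebra \<and> (\<forall>t. \<sigma> t d = exp (\<i> * complex_of_real (t * l)) *\<^sub>C d)"

lemma homogeneous_mem: "homogeneous l d \<Longrightarrow> d \<in> toeplitz_algebra"
  by (simp add: homogeneous_def)

lemma homogeneous_mult: "homogeneous l c \<Longrightarrow> homogeneous l' d \<Longrightarrow> homogeneous (l + l') (c * d)"
  by (auto simp: homogeneous_def flow_mult scaleC_mult_left scaleC_mult_right scaleC_scaleC
      algebra_simps simp flip: exp_add)

lemma homogeneous_adj: "homogeneous l d \<Longrightarrow> homogeneous (- l) (adj d)"
  by (auto simp: homogeneous_def flow_adj adj_scaleC exp_cnj)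

lemma homogeneous_add: "homogeneous l c \<Longrightarrow> homogeneous l d \<Longrightarrow> homogeneous l (c + d)"
  by (auto simp: homogeneous_def flow_add scaleC_add_right)

lemma homogeneous_scaleC: "homogeneous l d \<Longrightarrow> homogeneous l (c *\<^sub>C d)"
  by (auto simp: homogeneous_def flow_scaleC scaleC_scaleC mult.commute)

lemma homogeneous_gen_s: "homogeneous 0 gen_s"
  using dynamics by (auto simp: homogeneous_def toeplitz_dynamics_def scaleC_one)

lemma adj_gen_s_self: "adj gen_s * gen_s = 1"
  by (simp add: gen_s_def adj_toeplitz_isometry_self)

text \<open>\<open>star_automorphism\<close> does not mention the unit; invariance comes from 1 = s*
  s.\<close>

lemma homogeneous_one: "homogeneous 0 1"
  using homogeneous_mult[OF homogeneous_adj[OF homogeneous_gen_s] homogeneous_gen_s]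
  by (simp add: adj_gen_s_self)

text \<open>The flow is prescribed on s and on the prime isometries only. The general case follows
  from (m, a) = (m, 1)(0, a), by induction on m and on the prime factors of a.\<close>

lemma homogeneous_toeplitz_isometry: "homogeneous (ln (scale_part x)) (toeplitz_isometry x)"
proof -
  have v: "0 < a \<longrightarrow> homogeneous (ln a) (toeplitz_isometry (affine (0, a)))" for a :: nat
  proof (induction a rule: prime_divisors_induct)
    case (unit a)
    have "affine (0, 1) = 1" by (simp add: affine_nat_eq_iff)
    then show ?case using unit homogeneous_one by (simp add: toeplitz_isometry_one)
  next
    case (factor p a)
    show ?case
    proof
      assume "0 < p * a"
      then have pos: "0 < p" "0 < a" by auto
      have "\<sigma> t (gen_v p) = exp (\<i> * complex_of_real (t * ln p)) *\<^sub>C gen_v p" for t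
        using dynamics factor(1) pos
        by (simp add: toeplitz_dynamics_def powr_def Ln_of_nat mult.assoc)
      then have "homogeneous (ln p) (gen_v p)" by (auto simp: homogeneous_def gen_v_def)
      moreover have "affine (0, p * a) = affine (0, p) * affine (0, a)"
        using pos by (simp add: affine_nat_eq_iff)
      ultimately show "homogeneous (ln (p * a)) (toeplitz_isometry (affine (0, p * a)))"
        using homogeneous_mult[of "ln p" "gen_v p"] factor(2) pos
        by (simp add: toeplitz_isometry_mult gen_v_def ln_mult)
    qed
  qed simp
  have s: "homogeneous 0 (toeplitz_isometry (affine (m, 1)))" for m
  proof (induction m)
    case 0
    have "affine (0, 1) = 1" by (simp add: affine_nat_eq_iff)
    then show ?case using homogeneous_one by (simp add: toeplitz_isometry_one)
  next
    case (Suc m)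
    have "affine (Suc m, 1) = affine (1, 1) * affine (m, 1)" by (simp add: affine_nat_eq_iff)
    then show ?case
      using homogeneous_mult[OF homogeneous_gen_s Suc] by (simp add: toeplitz_isometry_mult gen_s_def)
  qed
  have "x = affine (shift_part x, 1) * affine (0, scale_part x)" by (simp add: affine_nat_eq_iff)
  then have "toeplitz_isometry x
      = toeplitz_isometry (affine (shift_part x, 1)) * toeplitz_isometry (affine (0, scale_part x))"
    by (metis toeplitz_isometry_mult)
  then show ?thesis
    using homogeneous_mult[OF s v[rule_format], of "scale_part x" "shift_part x"] by simp
qed

lemma homogeneous_word:
  "homogeneous (ln (scale_part x) - ln (scale_part y)) (toeplitz_isometry x * adj (toeplitz_isometry y))"
  using homogeneous_mult[OF homogeneous_toeplitz_isometry homogeneous_adj[OF homogeneous_toeplitz_isometry]]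
  by simp

lemma homogeneous_entire_orbit:
  assumes "homogeneous l d"
  shows "entire_orbit toeplitz_algebra \<sigma> d (\<lambda>z. exp (\<i> * z * complex_of_real l) *\<^sub>C d)"
  unfolding entire_orbit_def
proof (intro conjI allI)
  show "range (\<lambda>z. exp (\<i> * z * complex_of_real l) *\<^sub>C d) \<subseteq> toeplitz_algebra"
    using homogeneous_mem[OF assms] by auto
  show "exp (\<i> * complex_of_real t * complex_of_real l) *\<^sub>C d = \<sigma> t d" for t
    using assms by (simp add: homogeneous_def mult.assoc)
  fix z
  have "((\<lambda>z. exp (\<i> * z * complex_of_real l)) has_field_derivative
      exp (\<i> * z * complex_of_real l) * (\<i> * complex_of_real l)) (at z)"
    by (auto intro!: derivative_eq_intros)
  then have "((\<lambda>z. exp (\<i> * z * complex_of_real l)) has_derivative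
      (\<lambda>h. exp (\<i> * z * complex_of_real l) * (\<i> * complex_of_real l) * h)) (at z)"
    by (simp add: has_field_derivative_def)
  from bounded_linear.has_derivative[OF bounded_linear_scaleC_left[of d] this]
  show "\<exists>D. ((\<lambda>z. exp (\<i> * z * complex_of_real l) *\<^sub>C d) has_derivative (\<lambda>h. h *\<^sub>C D)) (at z)"
    by (intro exI[of _ "(exp (\<i> * z * complex_of_real l) * (\<i> * complex_of_real l)) *\<^sub>C d"])
      (simp add: scaleC_scaleC mult_ac)
qed

lemma homogeneous_analytic: "homogeneous l d \<Longrightarrow> analytic_element toeplitz_algebra \<sigma> d"
  using homogeneous_entire_orbit homogeneous_mem by (auto simp: analytic_element_def)

text \<open>The entire orbit of c is exp (i z l) c, whose value at z = i \<beta> is exp (-\<beta> l)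
  c.\<close>

lemma kms_homogeneous:
  assumes "kms_state toeplitz_algebra \<sigma> \<beta> \<phi>" "homogeneous l c" "homogeneous l' d"
  shows "\<phi> (c * d) = complex_of_real (exp (- \<beta> * l)) * \<phi> (d * c)"
proof -
  have "\<phi> (c * d) = \<phi> (d * (exp (\<i> * (\<i> * complex_of_real \<beta>) * complex_of_real l) *\<^sub>C c))"
    using assms homogeneous_analytic homogeneous_entire_orbit[OF assms(2)]
    unfolding kms_state_def by blast
  also have "\<dots> = exp (\<i> * (\<i> * complex_of_real \<beta>) * complex_of_real l) * \<phi> (d * c)"
    using assms homogeneous_mem[OF assms(2)] homogeneous_mem[OF assms(3)]
    by (simp add: scaleC_mult_right kms_state_def state_def)
  also have "\<i> * (\<i> * complex_of_real \<beta>) * complex_of_real l = complex_of_real (- \<beta> * l)"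
    by (simp flip: mult.assoc)
  finally show ?thesis by (simp only: exp_of_real)
qed

section \<open>KMS states and the ideal generated by the corner projection\<close>

lemma homogeneous_corner: "homogeneous 0 (1 - gen_s * adj gen_s)"
proof -
  have "homogeneous 0 (1 + (- 1) *\<^sub>C (gen_s * adj gen_s))"
    using homogeneous_mult[OF homogeneous_gen_s homogeneous_adj[OF homogeneous_gen_s]]
    by (intro homogeneous_add homogeneous_one homogeneous_scaleC) simp
  then show ?thesis by (simp add: scaleC_neg_one)
qed

lemma corner_projection:
  "adj (1 - gen_s * adj gen_s) = 1 - gen_s * adj gen_s"
  "(1 - gen_s * adj gen_s) * (1 - gen_s * adj gen_s) = 1 - gen_s * adj gen_s"
proof -
  have "gen_s * adj gen_s * (gen_s * adj gen_s) = gen_s * (adj gen_s * gen_s) * adj gen_s"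
    by (simp only: mult.assoc)
  then show "(1 - gen_s * adj gen_s) * (1 - gen_s * adj gen_s) = 1 - gen_s * adj gen_s"
    by (simp add: algebra_simps adj_gen_s_self)
qed (simp add: adj_diff adj_mult)

text \<open>Cauchy-Schwarz controls P only when it stands at the left end. The KMS condition moves a
  homogeneous left factor to the right end, which brings P there; density removes homogeneity, first
  from b and then from a.\<close>

proposition kms_state_vanishes_on_ideal:
  assumes kms: "kms_state toeplitz_algebra \<sigma> \<beta> \<phi>" and ab: "a \<in> toeplitz_algebra" "b \<in> toeplitz_algebra"
  shows "\<phi> (a * (1 - gen_s * adj gen_s) * b) = 0"
proof -
  define P where "P = 1 - gen_s * adj gen_s"
  have state: "state toeplitz_algebra \<phi>" using kms by (simp add: kms_state_def)
  note bdd = toeplitz.state_bounded_functional[OF state]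
  have P: "P \<in> toeplitz_algebra" by (simp add: P_def)
  have "\<phi> (gen_s * adj gen_s) = 1"
    using kms_homogeneous[OF kms homogeneous_gen_s homogeneous_adj[OF homogeneous_gen_s]]
    by (simp add: adj_gen_s_self toeplitz.state_one[OF state])
  then have \<phi>P: "\<phi> P = 0"
    by (simp add: P_def toeplitz.bounded_functional_diff_arg[OF bdd] toeplitz.state_one[OF state])
  \<comment> \<open>P is a projection, so the factor \<open>\<phi> (adj P * P)\<close> in
    Cauchy-Schwarz equals \<open>\<phi> P = 0\<close>.\<close>
  have left: "\<phi> (P * y) = 0" if "y \<in> toeplitz_algebra" for y
    using toeplitz.state_Cauchy_Schwarz[OF state that P] corner_projection \<phi>P
    by (simp add: P_def)
  have words: "\<phi> (c * P * d) = 0" if "homogeneous l c" "homogeneous l' d" for l c l' d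
  proof -
    have "\<phi> (c * (P * d)) = complex_of_real (exp (- \<beta> * l)) * \<phi> (P * d * c)"
      using homogeneous_mult[OF homogeneous_corner that(2)]
      by (intro kms_homogeneous[OF kms that(1)]) (simp add: P_def)
    then show ?thesis using left[of "d * c"] homogeneous_mem that by (simp add: mult.assoc)
  qed
  have half: "\<phi> (c * (P * b)) = 0" if "homogeneous l c" for l c
  proof (rule toeplitz_functional_eq[where g="\<lambda>_. 0", OF _ bounded_functional_const_zero _ ab(2)])
    show "bounded_functional toeplitz_algebra (\<lambda>b. \<phi> (c * (P * b)))"
      using toeplitz.bounded_functional_mult_left[OF bdd, of "c * P"] homogeneous_mem[OF that] P
      by (simp add: mult.assoc)
  qed (use words[OF that homogeneous_word] in \<open>simp add: mult.assoc\<close>)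
  have "\<phi> (a * (P * b)) = 0"
  proof (rule toeplitz_functional_eq[where g="\<lambda>_. 0", OF _ bounded_functional_const_zero _ ab(1)])
    show "bounded_functional toeplitz_algebra (\<lambda>a. \<phi> (a * (P * b)))"
      using ab P by (intro toeplitz.bounded_functional_mult_right[OF bdd]) simp
  qed (rule half[OF homogeneous_word])
  then show ?thesis by (simp add: P_def mult.assoc)
qed

corollary kms_state_factors:
  assumes "kms_state toeplitz_algebra \<sigma> \<beta> \<phi>"
  shows "factors_through toeplitz_algebra q_add \<phi>"
  using kms_state_vanishes_on_ideal[OF assms] assms
  by (simp add: factors_through_q_add_iff toeplitz.state_bounded_functional kms_state_def)

corollary kms_infinity_state_factors:
  assumes "kms_infinity_state toeplitz_algebra \<sigma> \<phi>"
  shows "factors_through toeplitz_algebra q_add \<phi>"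
proof -
  let ?P = "1 - gen_s * adj gen_s"
  obtain \<F> :: "(real \<times> (affine_nat bop \<Rightarrow> complex)) filter" where \<F>: "\<F> \<noteq> bot"
      "\<forall>\<^sub>F (\<beta>, \<psi>) in \<F>. kms_state toeplitz_algebra \<sigma> \<beta> \<psi>"
      "\<And>x. x \<in> toeplitz_algebra \<Longrightarrow> ((\<lambda>(\<beta>, \<psi>). \<psi> x) \<longlongrightarrow> \<phi> x) \<F>"
    using assms unfolding kms_infinity_state_def by blast
  have "\<phi> (a * ?P * b) = 0" if ab: "a \<in> toeplitz_algebra" "b \<in> toeplitz_algebra" for a b
  proof (rule tendsto_unique[OF \<F>(1)])
    show "((\<lambda>(\<beta>, \<psi>). \<psi> (a * ?P * b)) \<longlongrightarrow> \<phi> (a * ?P * b)) \<F>"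
      using ab by (intro \<F>(3)) simp
    have "\<forall>\<^sub>F p in \<F>. (case p of (\<beta>, \<psi>) \<Rightarrow> \<psi> (a * ?P * b)) = 0"
      using \<F>(2) by eventually_elim (use kms_state_vanishes_on_ideal[OF _ ab] in auto)
    then show "((\<lambda>(\<beta>, \<psi>). \<psi> (a * ?P * b)) \<longlongrightarrow> 0) \<F>"
      by (rule tendsto_eventually)
  qed
  then show ?thesis
    using assms by (simp add: factors_through_q_add_iff toeplitz.state_bounded_functional kms_infinity_state_def)
qed

end


section \<open>A criterion for the KMS condition\<close>

context unital_cstar_subalgebra
begin

text \<open>Difference quotients along a sequence tending to 0 lie in the closed set A. Membership
  matters because a functional is only controlled on A.\<close>

lemma has_derivative_mem:
  assumes F: "range F \<subseteq> A" "(F has_derivative (\<lambda>h. h *\<^sub>C D)) (at (z :: complex))"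
  shows "D \<in> A"
proof -
  have F_mem: "F w \<in> A" for w using F(1) by auto
  define h :: "nat \<Rightarrow> complex" where "h n = complex_of_real (inverse (real (Suc n)))" for n
  have "h \<longlonglongrightarrow> complex_of_real 0"
    unfolding h_def by (intro tendsto_of_real LIMSEQ_inverse_real_of_nat)
  moreover have h_nz: "h n \<noteq> 0" for n by (simp add: h_def del: of_nat_Suc)
  ultimately have "filterlim h (at 0) sequentially"
    by (simp add: filterlim_at)
  moreover have "((\<lambda>h. norm (F (z + h) - F z - h *\<^sub>C D) / norm h) \<longlongrightarrow> 0) (at 0)"
    using F(2) by (simp add: has_derivative_at)
  ultimately have "(\<lambda>n. norm (F (z + h n) - F z - h n *\<^sub>C D) / norm (h n)) \<longlonglongrightarrow> 0"
    by (rule filterlim_compose[rotated])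
  moreover have "norm (F (z + h n) - F z - h n *\<^sub>C D) / norm (h n)
      = norm (inverse (h n) *\<^sub>C (F (z + h n) - F z) - D)" for n
  proof -
    have "inverse (h n) *\<^sub>C (F (z + h n) - F z) - D = inverse (h n) *\<^sub>C (F (z + h n) - F z - h n *\<^sub>C D)"
      by (simp add: scaleC_diff_right scaleC_scaleC scaleC_one h_nz)
    then show ?thesis by (simp add: norm_scaleC norm_inverse divide_inverse mult.commute)
  qed
  ultimately have "(\<lambda>n. inverse (h n) *\<^sub>C (F (z + h n) - F z)) \<longlonglongrightarrow> D"
    by (simp add: tendsto_norm_zero_iff LIM_zero_iff)
  then show ?thesis
    by (rule closed_sequentially[OF closed_carrier, rotated]) (simp add: F_mem)
qed

text \<open>As f is linear and bounded on A alone, its bound is applied directly to the remainder of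
  F, which lies in A.\<close>

lemma bounded_functional_has_field_derivative:
  assumes f: "bounded_functional A f"
    and F: "range F \<subseteq> A" "(F has_derivative (\<lambda>h. h *\<^sub>C D)) (at (z :: complex))"
  shows "((\<lambda>z. f (F z)) has_field_derivative f D) (at z)"
proof -
  obtain K where K: "0 \<le> K" "\<And>x. x \<in> A \<Longrightarrow> cmod (f x) \<le> K * norm x"
    by (rule bounded_functional_bound[OF f]) blast
  have D: "D \<in> A" by (rule has_derivative_mem[OF F])
  have "((\<lambda>h. norm (f (F (z + h)) - f (F z) - f D * h) / norm h) \<longlongrightarrow> 0) (at 0)"
  proof (rule Lim_null_comparison)
    show "((\<lambda>h. K * (norm (F (z + h) - F z - h *\<^sub>C D) / norm h)) \<longlongrightarrow> 0) (at 0)"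
      using F(2) by (intro tendsto_mult_right_zero) (simp add: has_derivative_at)
    have "norm (norm (f (F (z + h)) - f (F z) - f D * h) / norm h)
        \<le> K * (norm (F (z + h) - F z - h *\<^sub>C D) / norm h)" for h
    proof -
      have mem: "F (z + h) \<in> A" "F z \<in> A" using F(1) by auto
      have "f (F (z + h)) - f (F z) - f D * h = f (F (z + h) - F z - h *\<^sub>C D)"
        using mem D by (simp add: bounded_functional_diff_arg[OF f] bounded_functional_scaleC[OF f])
      then show ?thesis
        using K(2)[of "F (z + h) - F z - h *\<^sub>C D"] mem D by (simp add: divide_right_mono)
    qed
    then show "\<forall>\<^sub>F h in at 0. norm (norm (f (F (z + h)) - f (F z) - f D * h) / norm h)
        \<le> K * (norm (F (z + h) - F z - h *\<^sub>C D) / norm h)"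
      by simp
  qed
  then show ?thesis
    by (simp add: has_field_derivative_def has_derivative_at bounded_linear_mult_right)
qed

lemma bounded_functional_holomorphic:
  assumes "bounded_functional A f" "entire_orbit A \<sigma> c F"
  shows "(\<lambda>z. f (F z)) holomorphic_on UNIV"
  unfolding holomorphic_on_def
proof
  fix z
  obtain D where "(F has_derivative (\<lambda>h. h *\<^sub>C D)) (at z)"
    using assms(2) unfolding entire_orbit_def by blast
  then show "(\<lambda>z. f (F z)) field_differentiable at z within UNIV"
    using bounded_functional_has_field_derivative[OF assms(1)] assms(2)
    by (auto simp: entire_orbit_def field_differentiable_def)
qed

end

lemma entire_eq_if_eq_on_reals:
  assumes "f holomorphic_on UNIV" "g holomorphic_on UNIV"
    and "\<And>t. f (complex_of_real t) = g (complex_of_real t)"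
  shows "f z = g z"
proof -
  have "0 islimpt range complex_of_real"
    unfolding islimpt_approachable
  proof (intro allI impI)
    fix e :: real assume "0 < e"
    then have "complex_of_real (e / 2) \<noteq> 0 \<and> dist (complex_of_real (e / 2)) 0 < e" by simp
    then show "\<exists>x'\<in>range complex_of_real. x' \<noteq> 0 \<and> dist x' 0 < e" by blast
  qed
  moreover have "(\<lambda>z. f z - g z) holomorphic_on UNIV"
    using assms by (intro holomorphic_intros)
  ultimately have "(\<lambda>z. f z - g z) z = 0"
    using assms(3)
    by (intro analytic_continuation[of "\<lambda>z. f z - g z" UNIV "range complex_of_real" 0 z]) auto
  then show ?thesis by simp
qed

section \<open>From a commutation rule for isometries to the full KMS condition\<close>

context toeplitz_flow
begin

lemma flow_one: "\<sigma> t 1 = 1"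
proof -
  have "\<sigma> t (adj gen_s * gen_s) = adj (\<sigma> t gen_s) * \<sigma> t gen_s" by (simp add: flow_mult flow_adj)
  also have "\<sigma> t gen_s = gen_s" using dynamics by (simp add: toeplitz_dynamics_def)
  finally show ?thesis by (simp add: adj_gen_s_self)
qed

lemma state_flow: "state toeplitz_algebra \<psi> \<Longrightarrow> state toeplitz_algebra (\<lambda>x. \<psi> (\<sigma> t x))"
  by (simp add: state_def flow_add flow_scaleC flow_mult flow_adj flow_one)

context
  fixes \<psi> :: "affine_nat bop \<Rightarrow> complex" and \<beta> :: real
  assumes state: "state toeplitz_algebra \<psi>" and \<beta>: "\<beta> \<noteq> 0"
    and twist: "\<And>x y. x \<in> toeplitz_algebra \<Longrightarrow>
      \<psi> (x * toeplitz_isometry y) = complex_of_real (exp (\<beta> * ln (scale_part y))) * \<psi> (toeplitz_isometry y * x)"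
begin

text \<open>The rule \<open>twist\<close> is the KMS relation for isometries. Its adjoint, the state
  being hermitian, handles \<open>adj (toeplitz_isometry w)\<close> with the inverse factor.\<close>

lemma twist_word:
  assumes x: "x \<in> toeplitz_algebra"
  shows "\<psi> (x * (toeplitz_isometry u * adj (toeplitz_isometry w)))
    = complex_of_real (exp (\<beta> * (ln (scale_part u) - ln (scale_part w))))
      * \<psi> (toeplitz_isometry u * adj (toeplitz_isometry w) * x)"
proof -
  let ?u = "toeplitz_isometry u" and ?w = "toeplitz_isometry w"
  have tw: "\<psi> (y * adj ?w) = complex_of_real (exp (- (\<beta> * ln (scale_part w)))) * \<psi> (adj ?w * y)"
    if y: "y \<in> toeplitz_algebra" for y
  proof -
    have "\<psi> (adj ?w * y) = cnj (\<psi> (adj y * ?w))"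
      using toeplitz.state_adj[OF state, of "adj y * ?w"] y by (simp add: adj_mult)
    also have "\<dots> = complex_of_real (exp (\<beta> * ln (scale_part w))) * cnj (\<psi> (?w * adj y))"
      using y by (simp add: twist)
    also have "cnj (\<psi> (?w * adj y)) = \<psi> (y * adj ?w)"
      using toeplitz.state_adj[OF state, of "?w * adj y"] y by (simp add: adj_mult)
    finally show ?thesis by (simp add: exp_minus)
  qed
  have "\<psi> (x * ?u * adj ?w) = complex_of_real (exp (- (\<beta> * ln (scale_part w)))) * \<psi> (adj ?w * x * ?u)"
    using tw[of "x * ?u"] x by (simp add: mult.assoc)
  also have "\<psi> (adj ?w * x * ?u) = complex_of_real (exp (\<beta> * ln (scale_part u))) * \<psi> (?u * (adj ?w * x))"
    using x by (intro twist) simp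
  finally show ?thesis
    by (simp add: mult.assoc right_diff_distrib exp_diff exp_minus field_simps)
qed

text \<open>Taking x = 1 in \<open>twist_word\<close> shows that a word of nonzero degree has value
  0, because \<beta> \<noteq> 0; words of degree 0 are fixed.\<close>

lemma twist_invariant:
  assumes "x \<in> toeplitz_algebra"
  shows "\<psi> (\<sigma> t x) = \<psi> x"
proof (rule toeplitz_functional_eq[where f="\<lambda>x. \<psi> (\<sigma> t x)" and g=\<psi>])
  show "bounded_functional toeplitz_algebra (\<lambda>x. \<psi> (\<sigma> t x))" "bounded_functional toeplitz_algebra \<psi>"
    by (intro toeplitz.state_bounded_functional state state_flow)+
  fix u w
  let ?d = "toeplitz_isometry u * adj (toeplitz_isometry w)" and ?l = "ln (scale_part u) - ln (scale_part w)"
  have "\<psi> ?d = complex_of_real (exp (\<beta> * ?l)) * \<psi> ?d"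
    using twist_word[OF toeplitz.one_mem, of u w] by simp
  then have "?l = 0 \<or> \<psi> ?d = 0" using \<beta> by auto
  moreover have "\<psi> (\<sigma> t ?d) = exp (\<i> * complex_of_real (t * ?l)) * \<psi> ?d"
    using homogeneous_word[of u w] by (simp add: homogeneous_def toeplitz.state_scaleC[OF state])
  ultimately show "\<psi> (\<sigma> t ?d) = \<psi> ?d" by auto
qed (rule assms)

text \<open>Here c is any analytic element, so its orbit is not explicit. With d a word, invariance
  determines \<open>\<psi> (d * F z)\<close> for real z, the identity theorem carries the formula to
  z = i \<beta>, and there \<open>twist_word\<close> identifies it.\<close>

lemma twist_kms_state: "kms_state toeplitz_algebra \<sigma> \<beta> \<psi>"
proof -
  note bdd = toeplitz.state_bounded_functional[OF state]
  have "\<psi> (c * d) = \<psi> (d * F (\<i> * complex_of_real \<beta>))"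
    if c: "c \<in> toeplitz_algebra" and F: "entire_orbit toeplitz_algebra \<sigma> c F" and d: "d \<in> toeplitz_algebra"
    for c d F
  proof -
    have F_mem: "F z \<in> toeplitz_algebra" for z using F by (auto simp: entire_orbit_def)
    show ?thesis
    proof (rule toeplitz_functional_eq[where f="\<lambda>d. \<psi> (c * d)" and g="\<lambda>d. \<psi> (d * F (\<i> * complex_of_real \<beta>))"])
      show "bounded_functional toeplitz_algebra (\<lambda>d. \<psi> (c * d))"
        by (rule toeplitz.bounded_functional_mult_left[OF bdd c])
      show "bounded_functional toeplitz_algebra (\<lambda>d. \<psi> (d * F (\<i> * complex_of_real \<beta>)))"
        by (rule toeplitz.bounded_functional_mult_right[OF bdd F_mem])
      fix u w
      define d where "d = toeplitz_isometry u * adj (toeplitz_isometry w)"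
      define l where "l = ln (scale_part u) - ln (scale_part w)"
      have hom: "homogeneous l d" unfolding d_def l_def by (rule homogeneous_word)
      have d: "d \<in> toeplitz_algebra" by (rule homogeneous_mem[OF hom])
      have "\<psi> (d * F (complex_of_real t)) = exp (- \<i> * complex_of_real t * complex_of_real l) * \<psi> (d * c)" for t
      proof -
        have "\<psi> (d * c) = \<psi> (\<sigma> t (d * c))" using c d by (simp add: twist_invariant)
        also have "\<dots> = exp (\<i> * complex_of_real (t * l)) * \<psi> (d * F (complex_of_real t))"
          using hom c d F F_mem
          by (simp add: flow_mult homogeneous_def scaleC_mult_left toeplitz.state_scaleC[OF state] entire_orbit_def)
        finally show ?thesis by (simp add: exp_minus mult.assoc field_simps)
      qed
      moreover have "(\<lambda>z. \<psi> (d * F z)) holomorphic_on UNIV"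
        by (rule toeplitz.bounded_functional_holomorphic[OF toeplitz.bounded_functional_mult_left[OF bdd d] F])
      moreover have "(\<lambda>z. exp (- \<i> * z * complex_of_real l) * \<psi> (d * c)) holomorphic_on UNIV"
        by (intro holomorphic_intros)
      ultimately have "\<psi> (d * F z) = exp (- \<i> * z * complex_of_real l) * \<psi> (d * c)" for z
        by (rule entire_eq_if_eq_on_reals[rotated 2])
      then have "\<psi> (d * F (\<i> * complex_of_real \<beta>))
          = exp (- \<i> * (\<i> * complex_of_real \<beta>) * complex_of_real l) * \<psi> (d * c)" .
      also have "- \<i> * (\<i> * complex_of_real \<beta>) * complex_of_real l = complex_of_real (\<beta> * l)"
        by (simp flip: mult.assoc)
      also have "exp (complex_of_real (\<beta> * l)) * \<psi> (d * c) = \<psi> (c * d)"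
        using twist_word[OF c, of u w] by (simp only: d_def l_def exp_of_real)
      finally show "\<psi> (c * (toeplitz_isometry u * adj (toeplitz_isometry w)))
          = \<psi> (toeplitz_isometry u * adj (toeplitz_isometry w) * F (\<i> * complex_of_real \<beta>))"
        by (simp only: d_def)
    qed (rule d)
  qed
  then show ?thesis
    using state \<beta> by (auto simp: kms_state_def analytic_element_def)
qed

end

end


section \<open>Ground states\<close>

lemma toeplitz_isometry_eq_gen_s_power: "scale_part x = 1 \<Longrightarrow> toeplitz_isometry x = gen_s ^ shift_part x"
proof (induction "shift_part x" arbitrary: x)
  case 0
  then have "x = 1" by (simp add: affine_nat_eq_iff)
  then show ?case by (simp add: toeplitz_isometry_one)
next
  case (Suc m)
  have "x = affine (1, 1) * affine (m, 1)"
    using Suc(2,3) by (simp add: affine_nat_eq_iff)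
  moreover have "toeplitz_isometry (affine (m, 1)) = gen_s ^ m"
    using Suc(1)[of "affine (m, 1)"] by simp
  ultimately show ?case by (simp add: toeplitz_isometry_mult gen_s_def flip: Suc(2))
qed

context toeplitz_flow
begin

context
  fixes \<phi> :: "affine_nat bop \<Rightarrow> complex"
  assumes ground: "ground_state toeplitz_algebra \<sigma> \<phi>"
begin

lemma ground_is_state: "state toeplitz_algebra \<phi>"
  using ground by (simp add: ground_state_def)

lemma ground_bounded_functional: "bounded_functional toeplitz_algebra \<phi>"
  by (rule toeplitz.state_bounded_functional[OF ground_is_state])

text \<open>On a homogeneous \<open>d\<close> of negative degree \<open>l\<close> the factor \<open>exp (\<i> * z * l)\<close> is unbounded on the
  upper half-plane, which forces the coefficient \<open>\<phi> (c * d)\<close> to vanish.\<close>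

lemma ground_negative_degree_right:
  assumes d: "homogeneous l d" "l < 0" and c: "c \<in> toeplitz_algebra"
  shows "\<phi> (c * d) = 0"
proof (rule toeplitz_functional_eq[where f="\<lambda>c. \<phi> (c * d)" and g="\<lambda>_. 0"])
  show "bounded_functional toeplitz_algebra (\<lambda>c. \<phi> (c * d))"
    by (rule toeplitz.bounded_functional_mult_right[OF ground_bounded_functional homogeneous_mem[OF d(1)]])
  \<comment> \<open>The ground condition concerns analytic left factors, and words are analytic;
    density extends the conclusion to every c.\<close>
  fix u w
  let ?c = "toeplitz_isometry u * adj (toeplitz_isometry w)"
  have "bounded ((\<lambda>z. \<phi> (?c * (exp (\<i> * z * complex_of_real l) *\<^sub>C d))) ` {z. 0 < Im z})"
    using ground homogeneous_analytic[OF homogeneous_word] homogeneous_analytic[OF d(1)]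
      homogeneous_entire_orbit[OF d(1)]
    unfolding ground_state_def by blast
  then obtain B where B: "\<And>z. 0 < Im z \<Longrightarrow> cmod (\<phi> (?c * (exp (\<i> * z * complex_of_real l) *\<^sub>C d))) \<le> B"
    unfolding bounded_iff by auto
  have le: "exp (- l * y) * cmod (\<phi> (?c * d)) \<le> B" if "0 < y" for y
  proof -
    have "\<i> * (\<i> * complex_of_real y) * complex_of_real l = complex_of_real (- l * y)"
      by (simp flip: mult.assoc)
    then have "cmod (\<phi> (?c * (exp (complex_of_real (- l * y)) *\<^sub>C d))) \<le> B"
      using B[of "\<i> * complex_of_real y"] that by (simp only: Im_i_times Re_complex_of_real)
    moreover have "\<phi> (?c * (exp (complex_of_real (- l * y)) *\<^sub>C d)) = exp (complex_of_real (- l * y)) * \<phi> (?c * d)"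
      using homogeneous_mem[OF d(1)] by (simp add: scaleC_mult_right toeplitz.state_scaleC[OF ground_is_state])
    ultimately show ?thesis by (simp add: norm_mult)
  qed
  show "\<phi> (?c * d) = 0"
  proof (rule ccontr)
    assume "\<phi> (?c * d) \<noteq> 0"
    then have k: "0 < cmod (\<phi> (?c * d))" by simp
    \<comment> \<open>Chosen so that -l y times the modulus of the value is |B| + 1; then exp t
      \<ge> 1 + t contradicts the bound B.\<close>
    define y where "y = (\<bar>B\<bar> + 1) / (- l * cmod (\<phi> (?c * d)))"
    have "0 < - l * cmod (\<phi> (?c * d))" using d(2) k by (simp add: mult_neg_pos)
    then have "0 < y" unfolding y_def by (intro divide_pos_pos) auto
    have "\<bar>B\<bar> + 1 = (- l * y) * cmod (\<phi> (?c * d))" using d(2) k by (simp add: y_def)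
    also have "\<dots> \<le> exp (- l * y) * cmod (\<phi> (?c * d))"
      using exp_ge_add_one_self[of "- l * y"] by (intro mult_right_mono norm_ge_zero) linarith
    also have "\<dots> \<le> B" by (rule le[OF \<open>0 < y\<close>])
    finally show False by simp
  qed
qed (auto simp: bounded_functional_const_zero c)

lemma ground_positive_degree_left:
  assumes d: "homogeneous l d" "0 < l" and c: "c \<in> toeplitz_algebra"
  shows "\<phi> (d * c) = 0"
proof -
  have "\<phi> (adj c * adj d) = 0"
    using ground_negative_degree_right[OF homogeneous_adj[OF d(1)], of "adj c"] d(2) c by simp
  then show ?thesis
    using toeplitz.state_adj[OF ground_is_state, of "d * c"] c homogeneous_mem[OF d(1)]
    by (simp add: adj_mult)
qed

text \<open>Multiplication by s preserves degrees, so both sides vanish when a factor of the word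
  has scale above 1. What remains are words in s and its adjoint, whose commutator with s is zero or
  contains 1 - s s*.\<close>

lemma ground_commutes_gen_s:
  assumes factors: "factors_through toeplitz_algebra q_add \<phi>" and y: "y \<in> toeplitz_algebra"
  shows "\<phi> (gen_s * y) = \<phi> (y * gen_s)"
proof (rule toeplitz_functional_eq[where f="\<lambda>y. \<phi> (gen_s * y)" and g="\<lambda>y. \<phi> (y * gen_s)"])
  show "bounded_functional toeplitz_algebra (\<lambda>y. \<phi> (gen_s * y))"
    by (rule toeplitz.bounded_functional_mult_left[OF ground_bounded_functional gen_s_mem])
  show "bounded_functional toeplitz_algebra (\<lambda>y. \<phi> (y * gen_s))"
    by (rule toeplitz.bounded_functional_mult_right[OF ground_bounded_functional gen_s_mem])
  fix u w
  let ?u = "toeplitz_isometry u" and ?w = "toeplitz_isometry w"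
  consider "1 < scale_part w" | "1 < scale_part u" | "scale_part u = 1" "scale_part w = 1"
    using scale_part_pos[of u] scale_part_pos[of w] by linarith
  then show "\<phi> (gen_s * (?u * adj ?w)) = \<phi> (?u * adj ?w * gen_s)"
  proof cases
    case 1
    then have neg: "- ln (scale_part w) < 0" by simp
    note hom = homogeneous_adj[OF homogeneous_toeplitz_isometry[of w]]
    have "\<phi> (gen_s * ?u * adj ?w) = 0"
      by (rule ground_negative_degree_right[OF hom neg]) simp
    moreover have "\<phi> (?u * (adj ?w * gen_s)) = 0"
      using homogeneous_mult[OF hom homogeneous_gen_s] neg
      by (intro ground_negative_degree_right) auto
    ultimately show ?thesis by (simp add: mult.assoc)
  next
    case 2
    then have pos: "0 < ln (scale_part u)" by simp
    note hom = homogeneous_toeplitz_isometry[of u]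
    have "\<phi> (gen_s * ?u * adj ?w) = 0"
      using homogeneous_mult[OF homogeneous_gen_s hom] pos
      by (intro ground_positive_degree_left) auto
    moreover have "\<phi> (?u * (adj ?w * gen_s)) = 0"
      by (rule ground_positive_degree_left[OF hom pos]) simp
    ultimately show ?thesis by (simp add: mult.assoc)
  next
    case 3
    define m where "m = shift_part u"
    have words: "?u = gen_s ^ m" "?w = gen_s ^ shift_part w"
      using 3 by (auto simp: m_def toeplitz_isometry_eq_gen_s_power)
    show ?thesis
    proof (cases "shift_part w")
      case 0
      then show ?thesis by (simp add: words power_commutes)
    next
      case (Suc k)
      let ?k = "adj (gen_s ^ k)"
      have "gen_s * (?u * adj ?w) = gen_s ^ m * (gen_s * adj gen_s) * ?k"
        unfolding words Suc power_Suc2 adj_mult by (simp add: power_commutes flip: mult.assoc)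
      moreover have "?u * adj ?w * gen_s = gen_s ^ m * ?k"
        unfolding words Suc power_Suc adj_mult by (simp add: mult.assoc adj_gen_s_self)
      ultimately have "?u * adj ?w * gen_s - gen_s * (?u * adj ?w) = gen_s ^ m * (1 - gen_s * adj gen_s) * ?k"
        by (simp add: algebra_simps)
      moreover have "\<phi> (gen_s ^ m * (1 - gen_s * adj gen_s) * ?k) = 0"
        using factors by (simp add: factors_through_q_add_iff[OF ground_bounded_functional])
      ultimately show ?thesis
        using toeplitz.bounded_functional_diff_arg[OF ground_bounded_functional,
            of "?u * adj ?w * gen_s" "gen_s * (?u * adj ?w)"] by simp
    qed
  qed
qed (rule y)

text \<open>By covariance the product is zero or starts with an isometry
  \<open>toeplitz_isometry u\<close>. Scale 1 for u would make z a right multiple of (0, b);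
  otherwise the degree is positive and \<phi> vanishes.\<close>

lemma ground_compress_scaling:
  assumes z: "\<nexists>z'. z = affine (0, b) * z'" and b: "0 < b" and y: "y \<in> toeplitz_algebra"
  shows "\<phi> (adj (toeplitz_isometry z) * (toeplitz_isometry (affine (0, b)) * y)) = 0"
proof (cases rule: adj_toeplitz_isometry_mult_cases[of z "affine (0, b)"])
  case 1
  then show ?thesis
    by (simp add: toeplitz.bounded_functional_zero[OF ground_bounded_functional] flip: mult.assoc)
next
  case (2 u w)
  have "scale_part u \<noteq> 1"
  proof
    assume u: "scale_part u = 1"
    have scale: "b * scale_part w = scale_part z" and shift: "b * shift_part w = shift_part z + scale_part z * shift_part u"
      using 2(1) u b by (auto simp: affine_nat_eq_iff)
    have "shift_part z = b * (shift_part w - scale_part w * shift_part u)"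
      using shift by (simp add: right_diff_distrib' flip: scale)
    \<comment> \<open>The subtraction does not truncate: \<open>shift\<close> bounds the subtrahend
      by \<open>shift_part w\<close>.\<close>
    then have "z = affine (0, b) * affine (shift_part w - scale_part w * shift_part u, scale_part w)"
      using b by (simp add: affine_nat_eq_iff scale)
    then show False using z by blast
  qed
  then have "1 < scale_part u" using scale_part_pos[of u] by linarith
  then have "0 < ln (scale_part u)" by simp
  then have "\<phi> (toeplitz_isometry u * (adj (toeplitz_isometry w) * y)) = 0"
    using y by (intro ground_positive_degree_left[OF homogeneous_toeplitz_isometry]) auto
  then show ?thesis by (simp add: 2(2) flip: mult.assoc)
qed

end

end


section \<open>Approximating a ground state by KMS states\<close>

definition residue_pairs :: "affine_nat set" where
  "residue_pairs = {z. shift_part z < scale_part z}"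

definition weight :: "real \<Rightarrow> affine_nat \<Rightarrow> real" where
  "weight \<beta> z = exp (- \<beta> * ln (scale_part z))"

lemma weight_nonneg: "0 \<le> weight \<beta> z"
  by (simp add: weight_def)

lemma weight_one: "weight \<beta> 1 = 1"
  by (simp add: weight_def)

lemma one_residue_pair: "1 \<in> residue_pairs"
  by (simp add: residue_pairs_def)

text \<open>There are a residues for each a, so the sum is that of a * a^(-3), that is,
  zeta(2).\<close>

lemma weight_summable_3: "weight 3 summable_on residue_pairs"
proof -
  let ?f = "\<lambda>(a, r). affine (r, a)"
  have bij: "bij_betw ?f (SIGMA a:{1..}. {..<a}) residue_pairs"
    by (rule bij_betw_byWitness[where f'="\<lambda>z. (scale_part z, shift_part z)"])
      (auto simp: residue_pairs_def affine_nat_eq_iff Suc_le_eq)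
  have w: "weight 3 (affine (r, a)) = 1 / real a ^ 3" if "0 < a" for r a
    using that exp_of_nat_mult[of 3 "ln (real a)"] by (simp add: weight_def exp_minus divide_inverse)
  have "summable (\<lambda>n. norm (inverse (real n ^ 2)))"
    using inverse_power_summable[of 2, where 'a=real] by simp
  then have "(\<lambda>n. inverse (real n ^ 2)) summable_on {1..}"
    by (rule summable_on_subset_banach[OF norm_summable_imp_summable_on]) simp
  moreover have "inverse (real a ^ 2) = real (card {..<a}) * (1 / real a ^ 3)" for a
    by (simp add: power2_eq_square power3_eq_cube field_simps)
  ultimately have "(\<lambda>a. \<Sum>r<a. 1 / real a ^ 3) summable_on {1..}"
    by simp
  then have "(\<lambda>(a, r). 1 / real a ^ 3) summable_on (SIGMA a:{1..}. {..<a})"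
    by (rule summable_on_SigmaI[rotated]) (auto intro: has_sum_finiteI)
  then have "(\<lambda>p. weight 3 (?f p)) summable_on (SIGMA a:{1..}. {..<a})"
    by (rule summable_on_cong[THEN iffD1, rotated]) (auto simp: w)
  then show ?thesis by (simp only: summable_on_reindex_bij_betw[OF bij])
qed

text \<open>Scale 1 forces shift 0 for a residue pair, so every z \<noteq> 1 has scale at least 2
  and gains the factor 2^(3 - \<beta>), uniformly in z.\<close>

lemma weight_le:
  assumes "3 \<le> \<beta>" "z \<noteq> 1" "z \<in> residue_pairs"
  shows "weight \<beta> z \<le> exp ((3 - \<beta>) * ln 2) * weight 3 z"
proof -
  have "scale_part z \<noteq> 1"
    using assms(2,3) by (auto simp: residue_pairs_def affine_nat_eq_iff)
  then have "2 \<le> scale_part z" using scale_part_pos[of z] by linarith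
  then have "ln 2 \<le> ln (real (scale_part z))" by simp
  then have "(3 - \<beta>) * ln (scale_part z) \<le> (3 - \<beta>) * ln 2"
    using assms(1) by (intro mult_left_mono_neg) auto
  then show ?thesis
    by (simp add: weight_def algebra_simps flip: exp_add)
qed

lemma weight_summable:
  assumes "3 \<le> \<beta>"
  shows "weight \<beta> summable_on residue_pairs"
proof -
  have "weight \<beta> z \<le> weight 3 z" for z
  proof -
    have "3 * ln (real (scale_part z)) \<le> \<beta> * ln (real (scale_part z))"
      using assms by (intro mult_right_mono) (auto simp: Suc_le_eq)
    then show ?thesis by (simp add: weight_def)
  qed
  then show ?thesis
    by (intro summable_on_comparison_test[OF weight_summable_3]) (auto simp: weight_nonneg)
qed

text \<open>Left multiplication by \<open>(1, 1)\<close> permutes the pairs \<open>(r, a)\<close> with \<open>r < a\<close> up to the wrap-around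
  \<open>(1, 1) (a - 1, a) = (0, a) (1, 1)\<close>.\<close>

definition rotate_residue :: "affine_nat \<Rightarrow> affine_nat" where
  "rotate_residue z = (if Suc (shift_part z) = scale_part z then affine (0, scale_part z)
     else affine (Suc (shift_part z), scale_part z))"

lemma bij_betw_rotate_residue: "bij_betw rotate_residue residue_pairs residue_pairs"
  by (rule bij_betw_byWitness[where f'="\<lambda>z. if shift_part z = 0 then affine (scale_part z - 1, scale_part z)
        else affine (shift_part z - 1, scale_part z)"])
    (auto simp: residue_pairs_def rotate_residue_def affine_nat_eq_iff)

lemma weight_rotate_residue: "weight \<beta> (rotate_residue z) = weight \<beta> z"
  by (simp add: weight_def rotate_residue_def)

text \<open>For z = (a - 1, a), the least common right multiple of (1, 1) and (0, a) is (a, a) = (1,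
  1) z = (0, a)(1, 1); the second identity is covariance for this pair.\<close>

lemma rotate_residue_wrap:
  assumes "Suc (shift_part z) = scale_part z"
  shows "gen_s * toeplitz_isometry z = toeplitz_isometry (rotate_residue z) * gen_s"
    and "adj (toeplitz_isometry (rotate_residue z)) * gen_s = gen_s * adj (toeplitz_isometry z)"
proof -
  have eq: "affine (1, 1) * z = rotate_residue z * affine (1, 1)"
    using assms by (simp add: rotate_residue_def affine_nat_eq_iff)
  then show "gen_s * toeplitz_isometry z = toeplitz_isometry (rotate_residue z) * gen_s"
    by (simp add: gen_s_def flip: toeplitz_isometry_mult)
  have "affine (1, 1) * p = rotate_residue z * q \<longleftrightarrow> (\<exists>r. p = z * r \<and> q = affine (1, 1) * r)" for p q
  proof
    assume *: "affine (1, 1) * p = rotate_residue z * q"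
    then have shift: "Suc (shift_part p) = scale_part z * shift_part q"
      and scale: "scale_part p = scale_part z * scale_part q"
      using assms by (auto simp: rotate_residue_def affine_nat_eq_iff)
    obtain j where j: "shift_part q = Suc j" using shift by (cases "shift_part q") auto
    have "p = z * affine (j, scale_part q) \<and> q = affine (1, 1) * affine (j, scale_part q)"
      using shift scale j assms by (auto simp: affine_nat_eq_iff)
    then show "\<exists>r. p = z * r \<and> q = affine (1, 1) * r" by blast
  next
    assume "\<exists>r. p = z * r \<and> q = affine (1, 1) * r"
    then show "affine (1, 1) * p = rotate_residue z * q"
      using eq by (metis mult.assoc)
  qed
  then show "adj (toeplitz_isometry (rotate_residue z)) * gen_s = gen_s * adj (toeplitz_isometry z)"
    unfolding gen_s_def by (rule adj_toeplitz_isometry_mult)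
qed

lemma rotate_residue_step:
  assumes "z \<in> residue_pairs" "Suc (shift_part z) \<noteq> scale_part z"
  shows "gen_s * toeplitz_isometry z = toeplitz_isometry (rotate_residue z)"
    and "adj (toeplitz_isometry (rotate_residue z)) * gen_s = adj (toeplitz_isometry z)"
proof -
  have "affine (1, 1) * z = rotate_residue z"
    using assms by (simp add: rotate_residue_def affine_nat_eq_iff)
  then show *: "gen_s * toeplitz_isometry z = toeplitz_isometry (rotate_residue z)"
    by (simp add: gen_s_def flip: toeplitz_isometry_mult)
  have "adj gen_s * gen_s = 1" by (simp add: gen_s_def adj_toeplitz_isometry_self)
  then show "adj (toeplitz_isometry (rotate_residue z)) * gen_s = adj (toeplitz_isometry z)"
    by (simp add: adj_mult mult.assoc flip: *)
qed

lemma state_compress: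
  assumes "state toeplitz_algebra \<phi>"
  shows "state toeplitz_algebra (\<lambda>x. \<phi> (adj (toeplitz_isometry z) * x * toeplitz_isometry z))"
proof -
  let ?T = "toeplitz_isometry z"
  have "\<phi> (adj ?T * (adj x * x) * ?T) \<in> \<real>\<^sub>\<ge>\<^sub>0" if "x \<in> toeplitz_algebra" for x
    using toeplitz.state_positive[OF assms, of "x * ?T"] that by (simp add: adj_mult mult.assoc)
  then show ?thesis
    using assms
    by (simp add: state_def distrib_left distrib_right scaleC_mult_left scaleC_mult_right
        adj_toeplitz_isometry_self)
qed

section \<open>The weighted sums, their KMS property and their limit\<close>

context toeplitz_flow
begin

context
  fixes \<phi> :: "affine_nat bop \<Rightarrow> complex"
  assumes ground: "ground_state toeplitz_algebra \<sigma> \<phi>"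
    and factors: "factors_through toeplitz_algebra q_add \<phi>"
begin

definition compress :: "affine_nat \<Rightarrow> affine_nat bop \<Rightarrow> complex" where
  "compress z x = \<phi> (adj (toeplitz_isometry z) * x * toeplitz_isometry z)"

definition weighted_sum :: "real \<Rightarrow> affine_nat bop \<Rightarrow> complex" where
  "weighted_sum \<beta> x = (\<Sum>\<^sub>\<infinity>z\<in>residue_pairs. complex_of_real (weight \<beta> z) * compress z x)"

definition partition_sum :: "real \<Rightarrow> real" where
  "partition_sum \<beta> = (\<Sum>\<^sub>\<infinity>z\<in>residue_pairs. weight \<beta> z)"

lemma compress_state: "state toeplitz_algebra (compress z)"
  using state_compress[OF ground_is_state[OF ground], of z] by (simp add: compress_def[abs_def])

lemma norm_compress_le: "x \<in> toeplitz_algebra \<Longrightarrow> norm (complex_of_real (weight \<beta> z) * compress z x) \<le> weight \<beta> z * norm x"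
  using toeplitz.state_bound[OF compress_state, of x z] weight_nonneg[of \<beta> z]
  by (simp add: norm_mult mult_left_mono)

context
  fixes \<beta> :: real
  assumes \<beta>: "3 \<le> \<beta>"
begin

lemma weighted_abs_summable:
  assumes "x \<in> toeplitz_algebra"
  shows "(\<lambda>z. norm (complex_of_real (weight \<beta> z) * compress z x)) summable_on residue_pairs"
  by (rule Infinite_Sum.abs_summable_on_comparison_test'[OF summable_on_cmult_left[OF weight_summable[OF \<beta>]]])
    (rule norm_compress_le[OF assms])

text \<open>The term z = 1 alone contributes 1, which keeps the normalising constant away from
  0.\<close>

lemma partition_sum_ge_1: "1 \<le> partition_sum \<beta>"
proof -
  have "(\<Sum>z\<in>{1}. weight \<beta> z) \<le> partition_sum \<beta>"
    unfolding partition_sum_def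
    by (rule finite_sum_le_infsum) (auto simp: weight_summable \<beta> one_residue_pair weight_nonneg)
  then show ?thesis by (simp add: weight_one)
qed

lemma weighted_sum_one: "weighted_sum \<beta> 1 = complex_of_real (partition_sum \<beta>)"
  using infsumI[OF has_sum_of_real[OF has_sum_infsum[OF weight_summable[OF \<beta>]], where 'a=complex]]
  by (simp add: weighted_sum_def partition_sum_def toeplitz.state_one[OF compress_state])

lemma weighted_state: "state toeplitz_algebra (\<lambda>x. weighted_sum \<beta> x / weighted_sum \<beta> 1)"
  unfolding state_def
proof (intro conjI ballI allI)
  fix x y assume mem: "x \<in> toeplitz_algebra" "y \<in> toeplitz_algebra"
  have "weighted_sum \<beta> (x + y) = weighted_sum \<beta> x + weighted_sum \<beta> y"
  proof -
    have summable: "(\<lambda>z. complex_of_real (weight \<beta> z) * compress z u) summable_on residue_pairs"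
      if "u \<in> toeplitz_algebra" for u
      by (rule abs_summable_summable[OF weighted_abs_summable[OF that]])
    show ?thesis
      using infsum_add[OF summable[OF mem(1)] summable[OF mem(2)]] mem
      by (simp add: weighted_sum_def distrib_left toeplitz.state_add[OF compress_state])
  qed
  then show "weighted_sum \<beta> (x + y) / weighted_sum \<beta> 1
      = weighted_sum \<beta> x / weighted_sum \<beta> 1 + weighted_sum \<beta> y / weighted_sum \<beta> 1"
    by (simp add: add_divide_distrib)
next
  fix c x assume x: "x \<in> toeplitz_algebra"
  have "weighted_sum \<beta> (c *\<^sub>C x) = c * weighted_sum \<beta> x"
    unfolding weighted_sum_def using x
    by (subst infsum_cmult_right'[symmetric]) (simp add: toeplitz.state_scaleC[OF compress_state] mult_ac)
  then show "weighted_sum \<beta> (c *\<^sub>C x) / weighted_sum \<beta> 1 = c * (weighted_sum \<beta> x / weighted_sum \<beta> 1)"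
    by simp
next
  fix x assume x: "x \<in> toeplitz_algebra"
  have pos: "compress z (adj x * x) \<in> \<real>\<^sub>\<ge>\<^sub>0" for z
    by (rule toeplitz.state_positive[OF compress_state x])
  then have real: "complex_of_real (weight \<beta> z) * compress z (adj x * x)
      = complex_of_real (weight \<beta> z * Re (compress z (adj x * x)))" for z
    by (auto simp: complex_nonneg_Reals_iff complex_eq_iff)
  have "norm (complex_of_real (weight \<beta> z) * compress z (adj x * x)) = weight \<beta> z * Re (compress z (adj x * x))" for z
    unfolding real norm_of_real using pos[of z] weight_nonneg[of \<beta> z] by (simp add: complex_nonneg_Reals_iff)
  then have "(\<lambda>z. weight \<beta> z * Re (compress z (adj x * x))) summable_on residue_pairs"
    using weighted_abs_summable[of "adj x * x"] x by simp
  then have eq: "weighted_sum \<beta> (adj x * x)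
      = complex_of_real (\<Sum>\<^sub>\<infinity>z\<in>residue_pairs. weight \<beta> z * Re (compress z (adj x * x)))"
    unfolding weighted_sum_def real by (intro infsumI has_sum_of_real has_sum_infsum)
  have "0 \<le> (\<Sum>\<^sub>\<infinity>z\<in>residue_pairs. weight \<beta> z * Re (compress z (adj x * x)))"
    using pos by (intro infsum_nonneg mult_nonneg_nonneg weight_nonneg) (auto simp: complex_nonneg_Reals_iff)
  then show "weighted_sum \<beta> (adj x * x) / weighted_sum \<beta> 1 \<in> \<real>\<^sub>\<ge>\<^sub>0"
    unfolding eq weighted_sum_one of_real_divide[symmetric]
    using partition_sum_ge_1 by (simp del: of_real_divide)
next
  show "weighted_sum \<beta> 1 / weighted_sum \<beta> 1 = 1"
    using partition_sum_ge_1 by (simp add: weighted_sum_one)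
qed

text \<open>The terms match one by one under the shift. Away from the wrap-around the operators
  inside \<phi> coincide; at the wrap-around a factor s must pass around \<phi>, which is where
  \<open>factors\<close> enters.\<close>

lemma weighted_sum_commutes_gen_s:
  assumes x: "x \<in> toeplitz_algebra"
  shows "weighted_sum \<beta> (x * gen_s) = weighted_sum \<beta> (gen_s * x)"
proof -
  let ?T = toeplitz_isometry
  have "compress z (x * gen_s) = compress (rotate_residue z) (gen_s * x)" if z: "z \<in> residue_pairs" for z
  proof (cases "Suc (shift_part z) = scale_part z")
    case True
    have "compress z (x * gen_s) = \<phi> (adj (?T z) * x * ?T (rotate_residue z) * gen_s)"
      by (simp add: compress_def mult.assoc rotate_residue_wrap(1)[OF True])
    also have "\<dots> = \<phi> (gen_s * (adj (?T z) * x * ?T (rotate_residue z)))"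
      using x by (intro ground_commutes_gen_s[OF ground factors, symmetric]) simp
    also have "\<dots> = compress (rotate_residue z) (gen_s * x)"
      by (simp add: compress_def flip: mult.assoc rotate_residue_wrap(2)[OF True])
    finally show ?thesis .
  next
    case False
    have "compress z (x * gen_s) = \<phi> (adj (?T z) * x * (gen_s * ?T z))"
      by (simp add: compress_def mult.assoc)
    also have "\<dots> = \<phi> (adj (?T (rotate_residue z)) * gen_s * x * ?T (rotate_residue z))"
      by (simp only: rotate_residue_step[OF z False])
    finally show ?thesis by (simp add: compress_def mult.assoc)
  qed
  then have "weighted_sum \<beta> (x * gen_s) = (\<Sum>\<^sub>\<infinity>z\<in>residue_pairs.
      complex_of_real (weight \<beta> (rotate_residue z)) * compress (rotate_residue z) (gen_s * x))"
    unfolding weighted_sum_def by (intro infsum_cong) (simp add: weight_rotate_residue)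
  also have "\<dots> = weighted_sum \<beta> (gen_s * x)"
    unfolding weighted_sum_def
    by (rule infsum_reindex_bij_betw[OF bij_betw_rotate_residue,
          of "\<lambda>z. complex_of_real (weight \<beta> z) * compress z (gen_s * x)"])
  finally show ?thesis .
qed

lemma weighted_sum_scaling:
  assumes x: "x \<in> toeplitz_algebra" and b: "0 < b"
  shows "weighted_sum \<beta> (toeplitz_isometry (affine (0, b)) * x)
    = complex_of_real (exp (- \<beta> * ln b)) * weighted_sum \<beta> (x * toeplitz_isometry (affine (0, b)))"
proof -
  let ?T = toeplitz_isometry and ?v = "affine (0, b)"
  let ?f = "\<lambda>z. complex_of_real (weight \<beta> z) * compress z (?T ?v * x)"
  have mem: "?v * z \<in> residue_pairs \<longleftrightarrow> z \<in> residue_pairs" for z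
    using b by (simp add: residue_pairs_def)
  have "weighted_sum \<beta> (?T ?v * x) = infsum ?f ((*) ?v ` residue_pairs)"
    unfolding weighted_sum_def
  proof (rule infsum_cong_neutral)
    \<comment> \<open>If (0, b) z' is a residue pair, so is z'. Hence this z is no multiple of (0,
      b) at all, and its term vanishes.\<close>
    fix z assume "z \<in> residue_pairs - (*) ?v ` residue_pairs"
    then have "\<nexists>z'. z = ?v * z'" using mem by auto
    then have "compress z (?T ?v * x) = 0"
      using ground_compress_scaling[OF ground _ b, of z "x * ?T z"] x by (simp add: compress_def mult.assoc)
    then show "?f z = 0" by simp
  qed (use mem in auto)
  also have "\<dots> = infsum (?f \<circ> (*) ?v) residue_pairs"
    by (rule infsum_reindex) (simp add: inj_on_def)
  also have "\<dots> = (\<Sum>\<^sub>\<infinity>z\<in>residue_pairs. complex_of_real (exp (- \<beta> * ln b)) *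
      (complex_of_real (weight \<beta> z) * compress z (x * ?T ?v)))"
  proof (rule infsum_cong)
    fix z
    have "adj (?T (?v * z)) * (?T ?v * x) * ?T (?v * z) = adj (?T z) * (adj (?T ?v) * ?T ?v) * x * ?T ?v * ?T z"
      by (simp add: toeplitz_isometry_mult adj_mult mult.assoc)
    then have "compress (?v * z) (?T ?v * x) = compress z (x * ?T ?v)"
      by (simp add: compress_def adj_toeplitz_isometry_self mult.assoc)
    moreover have "weight \<beta> (?v * z) = exp (- \<beta> * ln b) * weight \<beta> z"
      using b by (simp add: weight_def ln_mult distrib_left exp_add exp_diff exp_minus field_simps)
    ultimately show "(?f \<circ> (*) ?v) z = complex_of_real (exp (- \<beta> * ln b)) *
      (complex_of_real (weight \<beta> z) * compress z (x * ?T ?v))" by simp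
  qed
  also have "\<dots> = complex_of_real (exp (- \<beta> * ln b)) * weighted_sum \<beta> (x * ?T ?v)"
    unfolding weighted_sum_def by (rule infsum_cmult_right')
  finally show ?thesis .
qed

lemma weighted_sum_twist:
  assumes x: "x \<in> toeplitz_algebra"
  shows "weighted_sum \<beta> (x * toeplitz_isometry y)
    = complex_of_real (exp (\<beta> * ln (scale_part y))) * weighted_sum \<beta> (toeplitz_isometry y * x)"
proof -
  let ?s = "gen_s ^ shift_part y" and ?v = "toeplitz_isometry (affine (0, scale_part y))"
  \<comment> \<open>The induction ranges over all z, as each step absorbs one factor s into
    z.\<close>
  have s: "weighted_sum \<beta> (z * gen_s ^ m) = weighted_sum \<beta> (gen_s ^ m * z)" if "z \<in> toeplitz_algebra" for z m
    using that
  proof (induction m arbitrary: z)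
    case (Suc m)
    have "weighted_sum \<beta> (z * gen_s ^ Suc m) = weighted_sum \<beta> (z * gen_s * gen_s ^ m)"
      by (simp add: mult.assoc)
    also have "\<dots> = weighted_sum \<beta> (gen_s ^ m * z * gen_s)"
      using Suc.IH[of "z * gen_s"] Suc.prems by (simp add: mult.assoc)
    also have "\<dots> = weighted_sum \<beta> (gen_s * (gen_s ^ m * z))"
      using Suc.prems by (intro weighted_sum_commutes_gen_s) simp
    finally show ?case by (simp add: mult.assoc)
  qed simp
  have "y = affine (shift_part y, 1) * affine (0, scale_part y)" by (simp add: affine_nat_eq_iff)
  then have y: "toeplitz_isometry y = ?s * ?v"
    using toeplitz_isometry_eq_gen_s_power[of "affine (shift_part y, 1)"]
      toeplitz_isometry_mult[of "affine (shift_part y, 1)" "affine (0, scale_part y)"] by simp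
  have "weighted_sum \<beta> (x * toeplitz_isometry y) = weighted_sum \<beta> (x * ?s * ?v)"
    by (simp add: y mult.assoc)
  also have "\<dots> = complex_of_real (exp (\<beta> * ln (scale_part y))) * weighted_sum \<beta> (?v * (x * ?s))"
    using weighted_sum_scaling[of "x * ?s" "scale_part y"] x by (simp add: exp_minus)
  also have "weighted_sum \<beta> (?v * (x * ?s)) = weighted_sum \<beta> (toeplitz_isometry y * x)"
    using s[of "?v * x"] x by (simp add: y mult.assoc)
  finally show ?thesis .
qed

lemma weighted_kms_state: "kms_state toeplitz_algebra \<sigma> \<beta> (\<lambda>x. weighted_sum \<beta> x / weighted_sum \<beta> 1)"
  using \<beta> by (intro twist_kms_state weighted_state) (simp_all add: weighted_sum_twist)

text \<open>The term z = 1 equals \<open>\<phi> x\<close>; the rest is compared with the convergent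
  sum at 3, so that all dependence on \<beta> sits in the factor 2^(3 - \<beta>).\<close>

lemma weighted_sum_estimate:
  assumes x: "x \<in> toeplitz_algebra"
  shows "cmod (weighted_sum \<beta> x - \<phi> x) \<le> exp ((3 - \<beta>) * ln 2) * (partition_sum 3 * norm x)"
proof -
  let ?R = "residue_pairs - {1}"
  let ?f = "\<lambda>z. complex_of_real (weight \<beta> z) * compress z x"
  have abs: "(\<lambda>z. norm (?f z)) summable_on ?R"
    using weighted_abs_summable[OF x] by (rule summable_on_subset_banach) auto
  have "insert 1 ?R = residue_pairs" using one_residue_pair by auto
  then have "weighted_sum \<beta> x = ?f 1 + infsum ?f ?R"
    unfolding weighted_sum_def using infsum_insert[OF abs_summable_summable[OF abs], of 1] by simp
  then have "weighted_sum \<beta> x - \<phi> x = infsum ?f ?R"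
    by (simp add: weight_one compress_def toeplitz_isometry_one)
  then have "cmod (weighted_sum \<beta> x - \<phi> x) \<le> (\<Sum>\<^sub>\<infinity>z\<in>?R. norm (?f z))"
    using norm_infsum_bound[OF abs] by simp
  also have "\<dots> \<le> (\<Sum>\<^sub>\<infinity>z\<in>residue_pairs. exp ((3 - \<beta>) * ln 2) * norm x * weight 3 z)"
  proof (rule infsum_mono_neutral)
    fix z assume "z \<in> ?R \<inter> residue_pairs"
    then have "weight \<beta> z * norm x \<le> exp ((3 - \<beta>) * ln 2) * weight 3 z * norm x"
      using weight_le[OF \<beta>, of z] by (intro mult_right_mono) auto
    then show "norm (?f z) \<le> exp ((3 - \<beta>) * ln 2) * norm x * weight 3 z"
      using norm_compress_le[OF x, of \<beta> z] by (simp add: mult_ac)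
  qed (auto intro!: abs summable_on_cmult_right weight_summable_3 mult_nonneg_nonneg simp: weight_nonneg)
  also have "\<dots> = exp ((3 - \<beta>) * ln 2) * (partition_sum 3 * norm x)"
    unfolding partition_sum_def by (subst infsum_cmult_right') (simp add: mult_ac)
  finally show ?thesis .
qed

end

lemma weighted_sum_tendsto:
  assumes x: "x \<in> toeplitz_algebra"
  shows "((\<lambda>\<beta>. weighted_sum \<beta> x) \<longlongrightarrow> \<phi> x) at_top"
proof -
  have "((\<lambda>\<beta>. weighted_sum \<beta> x - \<phi> x) \<longlongrightarrow> 0) at_top"
  proof (rule Lim_null_comparison)
    show "\<forall>\<^sub>F \<beta> in at_top. cmod (weighted_sum \<beta> x - \<phi> x) \<le> exp ((3 - \<beta>) * ln 2) * (partition_sum 3 * norm x)"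
      using eventually_ge_at_top[of 3] by eventually_elim (rule weighted_sum_estimate[OF _ x])
    have "((\<lambda>\<beta>::real. exp ((3 - \<beta>) * ln 2)) \<longlongrightarrow> 0) at_top"
      by real_asymp
    then show "((\<lambda>\<beta>. exp ((3 - \<beta>) * ln 2) * (partition_sum 3 * norm x)) \<longlongrightarrow> 0) at_top"
      by (rule tendsto_mult_left_zero)
  qed
  then show ?thesis by (simp add: LIM_zero_iff)
qed

proposition ground_state_kms_infinity: "kms_infinity_state toeplitz_algebra \<sigma> \<phi>"
  unfolding kms_infinity_state_def
\<comment> \<open>The net is indexed by \<beta> itself. Its image filter depends only on large
  \<beta>, where the normalised sums are KMS states.\<close>
proof (intro conjI exI[of _ "filtermap (\<lambda>\<beta>. (\<beta>, \<lambda>x. weighted_sum \<beta> x / weighted_sum \<beta> 1)) at_top"] ballI)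
  show "state toeplitz_algebra \<phi>" by (rule ground_is_state[OF ground])
  show "filtermap (\<lambda>\<beta>. (\<beta>, \<lambda>x. weighted_sum \<beta> x / weighted_sum \<beta> 1)) at_top \<noteq> bot"
    by (simp add: filtermap_bot_iff)
  show "\<forall>\<^sub>F (\<beta>, \<psi>) in filtermap (\<lambda>\<beta>. (\<beta>, \<lambda>x. weighted_sum \<beta> x / weighted_sum \<beta> 1)) at_top.
      kms_state toeplitz_algebra \<sigma> \<beta> \<psi>"
    unfolding eventually_filtermap
    using eventually_ge_at_top[of 3] by eventually_elim (simp add: weighted_kms_state)
  show "filterlim fst at_top (filtermap (\<lambda>\<beta>. (\<beta>, \<lambda>x. weighted_sum \<beta> x / weighted_sum \<beta> 1)) at_top)"
    by (simp add: filterlim_filtermap filterlim_ident)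
  fix x assume x: "x \<in> toeplitz_algebra"
  have "((\<lambda>\<beta>. weighted_sum \<beta> x / weighted_sum \<beta> 1) \<longlongrightarrow> \<phi> x / \<phi> 1) at_top"
    using toeplitz.state_one[OF ground_is_state[OF ground]] x
    by (intro tendsto_divide weighted_sum_tendsto) auto
  then show "((\<lambda>(\<beta>, \<psi>). \<psi> x) \<longlongrightarrow> \<phi> x) (filtermap (\<lambda>\<beta>. (\<beta>, \<lambda>x. weighted_sum \<beta> x / weighted_sum \<beta> 1)) at_top)"
    by (simp add: filterlim_filtermap toeplitz.state_one[OF ground_is_state[OF ground]])
qed

end

end

theorem proposition4p1:
  fixes \<sigma> :: "real \<Rightarrow> affine_nat bop \<Rightarrow> affine_nat bop"
  assumes "toeplitz_dynamics \<sigma>"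
  shows "(\<forall>\<beta> \<phi>. kms_state toeplitz_algebra \<sigma> \<beta> \<phi> \<longrightarrow>
            factors_through toeplitz_algebra q_add \<phi>) \<and>
         (\<forall>\<phi>. kms_infinity_state toeplitz_algebra \<sigma> \<phi> \<longrightarrow>
            factors_through toeplitz_algebra q_add \<phi>) \<and>
         (\<forall>\<phi>. ground_state toeplitz_algebra \<sigma> \<phi> \<longrightarrow>
            (factors_through toeplitz_algebra q_add \<phi> \<longleftrightarrow>
             kms_infinity_state toeplitz_algebra \<sigma> \<phi>))"
proof -
  interpret toeplitz_flow \<sigma> by standard (rule assms)
  show ?thesis
    using kms_state_factors kms_infinity_state_factors ground_state_kms_infinity by blast
qed

end
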